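(* Let $n_1<n_2<n_3$ be positive integers with $\gcd(n_1,n_2,n_3)=1$ that minimally generate the numerical semigroup $S=\langle n_1,n_2,n_3\rangle$, and assume $S$ is not symmetric. Let $\delta_1=c_1-r_{12}-r_{13}$, $\delta_3=r_{31}+r_{32}-c_3$ and $g=\gcd(\delta_1,\delta_3)$. Then \[ \Delta(S)=\Big\{\, g\,i \;:\; i\in\{1,\ldots,\max\{\delta_1/g,\delta_3/g\}\},\ \text{the }\lambda\text{-B\'ezout couple of } i \text{ or the }\mu\text{-B\'ezout couple of } i \text{ for } (\delta_1/g,\delta_3/g) \text{ is irreducible}\Big\}. \]
   Context: $S=\langle n_1,n_2,n_3\rangle=\{x_1n_1+x_2n_2+x_3n_3 : x_i\in\mathbb N\}$; minimally generated means no $n_i$ lies in the submonoid generated by the other two. With $F=\max(\mathbb Z\setminus S)$, $S$ is symmetric if $x\in\mathbb Z\setminus S$ implies $F-x\in S$. For $\{i,j,k\}=\{1,2,3\}$, $c_i=\min\{c\in\mathbb Z^+ : cn_i\in\langle n_j,n_k\rangle\}$; when $S$ is not symmetric there are unique positive integers $r_{ij},r_{ik}$ with $c_in_i=r_{ij}n_j+r_{ik}n_k$ (and then $\delta_1,\delta_3$ are positive integers). For $s\in S$, the set of lengths is $\mathcal L(s)=\{x_1+x_2+x_3 : (x_1,x_2,x_3)\in\mathbb N^3,\ x_1n_1+x_2n_2+x_3n_3=s\}=\{m_1<\dots<m_k\}$, $\Delta(s)=\{m_t-m_{t-1}:2\le t\le k\}$, and $\Delta(S)=\bigcup_{s\in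 S}\Delta(s)$. B\'ezout couples: for coprime positive integers $p,q$ and $i\in\{1,\ldots,\max\{p,q\}\}$, the $\lambda$-B\'ezout couple of $i$ for $(p,q)$ is the unique $(x,y)\in\mathbb Z^2$ with $xp+yq=i$ and $0<y\le p$; the $\mu$-B\'ezout couple of $i$ for $(p,q)$ is the unique $(x,y)\in\mathbb Z^2$ with $xp+yq=i$ and $0<x\le q$. The $\lambda$-B\'ezout couple $\boldsymbol\lambda_i$ of $i$ is irreducible if there are no $j,k\in\{1,\ldots,\max\{p,q\}\}$ with $\boldsymbol\lambda_i=\boldsymbol\lambda_j+\boldsymbol\lambda_k$ (sum in $\mathbb Z^2$ of the $\lambda$-B\'ezout couples of $j$ and $k$); irreducibility of $\mu$-B\'ezout couples is defined in the same way using $\mu$-B\'ezout couples. *)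

theory Defs
  imports Main
begin

definition sg2 :: "nat \<Rightarrow> nat \<Rightarrow> nat set" where
  "sg2 a b = {x * a + y * b | x y. True}"

definition sg3 :: "nat \<Rightarrow> nat \<Rightarrow> nat \<Rightarrow> nat set" where
  "sg3 a b c = {x1 * a + x2 * b + x3 * c | x1 x2 x3. True}"

definition minimally_generated :: "nat \<Rightarrow> nat \<Rightarrow> nat \<Rightarrow> bool" where
  "minimally_generated a b c \<longleftrightarrow>
     a \<notin> sg2 b c \<and> b \<notin> sg2 a c \<and> c \<notin> sg2 a b"

definition frobenius :: "nat set \<Rightarrow> int" where
  "frobenius S = (GREATEST x::int. x \<notin> int ` S)"

definition symmetric_sg :: "nat set \<Rightarrow> bool" where
  "symmetric_sg S \<longleftrightarrow> (\<forall>x::int. x \<notin> int ` S \<longrightarrow> frobenius S - x \<in> int ` S)"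

definition cmin :: "nat \<Rightarrow> nat \<Rightarrow> nat \<Rightarrow> nat" where
  "cmin a b c = (LEAST m::nat. 0 < m \<and> m * a \<in> sg2 b c)"

definition rpair :: "nat \<Rightarrow> nat \<Rightarrow> nat \<Rightarrow> nat \<times> nat" where
  "rpair a b c = (THE (u, v). 0 < u \<and> 0 < v \<and> cmin a b c * a = u * b + v * c)"

definition lengths :: "nat \<Rightarrow> nat \<Rightarrow> nat \<Rightarrow> nat \<Rightarrow> nat set" where
  "lengths n1 n2 n3 s =
     {x1 + x2 + x3 | x1 x2 x3. x1 * n1 + x2 * n2 + x3 * n3 = s}"

definition delta_elem :: "nat set \<Rightarrow> int set" where
  "delta_elem L = {int b - int a | a b. a \<in> L \<and> b \<in> L \<and> a < b \<and>
                       \<not> (\<exists>m\<in>L. a < m \<and> m < b)}"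

definition delta_set :: "nat \<Rightarrow> nat \<Rightarrow> nat \<Rightarrow> int set" where
  "delta_set n1 n2 n3 = (\<Union>s\<in>sg3 n1 n2 n3. delta_elem (lengths n1 n2 n3 s))"

text \<open>Bezout couples for coprime positive p, q and i \<in> {1..max p q}.\<close>
definition lambda_bez :: "int \<Rightarrow> int \<Rightarrow> int \<Rightarrow> int \<times> int" where
  "lambda_bez p q i = (THE (x, y). x * p + y * q = i \<and> 0 < y \<and> y \<le> p)"

definition mu_bez :: "int \<Rightarrow> int \<Rightarrow> int \<Rightarrow> int \<times> int" where
  "mu_bez p q i = (THE (x, y). x * p + y * q = i \<and> 0 < x \<and> x \<le> q)"

definition padd :: "int \<times> int \<Rightarrow> int \<times> int \<Rightarrow> int \<times> int" where
  "padd u v = (fst u + fst v, snd u + snd v)"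

definition lambda_irred :: "int \<Rightarrow> int \<Rightarrow> int \<Rightarrow> bool" where
  "lambda_irred p q i \<longleftrightarrow>
     \<not> (\<exists>j\<in>{1..max p q}. \<exists>k\<in>{1..max p q}.
          lambda_bez p q i = padd (lambda_bez p q j) (lambda_bez p q k))"

definition mu_irred :: "int \<Rightarrow> int \<Rightarrow> int \<Rightarrow> bool" where
  "mu_irred p q i \<longleftrightarrow>
     \<not> (\<exists>j\<in>{1..max p q}. \<exists>k\<in>{1..max p q}.
          mu_bez p q i = padd (mu_bez p q j) (mu_bez p q k))"

end

theory Submission
  imports Defs
begin

text \<open>
  Since S is not symmetric, the lattice of integer relations x n1 + y n2 + z n3 = 0 is freely generated
  by v1 = (c1, -r12, -r13) and v3 = (-r31, -r32, c3) (Herzog); measuring a vector by its coordinate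
  sum, v1 has length \<delta>1 > 0 and v3 has length -\<delta>3 < 0. A number d > 0 lies in the delta set iff
  some relation z of length d admits no relation w with 0 < length w < d and w \<ge> min(0, z)
  coordinatewise. Write z = a v1 + b v3. If a > 0 > b, then w = -v3 is admissible. Hence
  z = -(x v1 + y v3) or z = x v1 + y v3 with x, y \<ge> 0. Such a z has no admissible w iff it is not
  a sum of two vectors of positive length of the same kind, because \<delta>1/\<delta>3 lies strictly between
  r13/c3 and c1/r31, and because an indecomposable z has length at most \<delta>3 or \<delta>1, respectively.
  After division by gcd \<delta>1 \<delta>3 and reduction modulo the relation of length 0, the indecomposable
  vectors of the two kinds are the irreducible lambda- and mu-couples.
\<close>

section \<open>Gaps in the relation lattice\<close>

text \<open>If v1 and v3 have lengths \<open>p\<close> and \<open>- q\<close>, then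
  \<open>y * q - x * p\<close> is the length of - (x v1 + y v3). Exchanging \<open>p\<close> with
  \<open>q\<close> and \<open>x\<close> with \<open>y\<close> covers the vectors x v1 + y v3, so one
  predicate serves both kinds.\<close>

definition splits :: "int \<Rightarrow> int \<Rightarrow> int \<Rightarrow> int \<Rightarrow> bool" where
  "splits p q x y \<longleftrightarrow> (\<exists>x1 x2 y1 y2. 0 \<le> x1 \<and> 0 \<le> x2 \<and> 0 \<le> y1 \<and> 0 \<le> y2 \<and>
     x = x1 + x2 \<and> y = y1 + y2 \<and> 0 < y1 * q - x1 * p \<and> 0 < y2 * q - x2 * p)"

lemma splits_scale:
  assumes "0 < g"
  shows "splits (g * p) (g * q) x y \<longleftrightarrow> splits p q x y"
proof -
  have "0 < y * (g * q) - x * (g * p) \<longleftrightarrow> 0 < y * q - x * p" for x y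
  proof -
    have "y * (g * q) - x * (g * p) = g * (y * q - x * p)" by (simp add: algebra_simps)
    then show ?thesis using assms by (simp add: zero_less_mult_iff)
  qed
  then show ?thesis by (simp add: splits_def)
qed

text \<open>If the length exceeded \<open>q\<close>, the pair \<open>(0, 1)\<close>, of length
  \<open>q\<close>, could be split off and would leave a positive length.\<close>

lemma length_le_if_not_splits:
  assumes "0 < q" "0 \<le> x" "0 < y" "\<not> splits p q x y"
  shows "y * q - x * p \<le> q"
proof (rule ccontr)
  assume "\<not> ?thesis"
  then have "0 < (y - 1) * q - x * p" by (simp add: algebra_simps)
  then have "splits p q x y"
    unfolding splits_def using assms
    by (intro exI[of _ 0] exI[of _ x] exI[of _ 1] exI[of _ "y - 1"]) auto
  with assms show False by simp
qed

text \<open>The minimal relation for \<open>n2\<close> is - (v1 + v3), so v1 and v3 already span the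
  lattice (\<open>generated\<close>).\<close>

locale relation_lattice =
  fixes n1 n2 n3 c1 c3 r12 r13 r31 r32 :: int
  assumes n_order: "0 < n1" "n1 < n2" "n2 < n3"
    and r_pos: "0 < r12" "0 < r13" "0 < r31" "0 < r32"
    and r_less: "r31 < c1" "r13 < c3"
    and rel1: "c1 * n1 = r12 * n2 + r13 * n3"
    and rel3: "c3 * n3 = r31 * n1 + r32 * n2"
    and generated: "\<And>x y z. x * n1 + y * n2 + z * n3 = 0 \<Longrightarrow>
      \<exists>a b. x = a * c1 - b * r31 \<and> y = - a * r12 - b * r32 \<and> z = b * c3 - a * r13"
begin

definition "\<delta>1 = c1 - r12 - r13"
definition "\<delta>3 = r31 + r32 - c3"

section \<open>Lengths and slopes of the two basis vectors\<close>

lemma relation_eq_zero: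
  "(a * c1 - b * r31) * n1 + (- a * r12 - b * r32) * n2 + (b * c3 - a * r13) * n3 = 0"
proof -
  have "(a * c1 - b * r31) * n1 + (- a * r12 - b * r32) * n2 + (b * c3 - a * r13) * n3
      = a * (c1 * n1 - r12 * n2 - r13 * n3) + b * (c3 * n3 - r31 * n1 - r32 * n2)"
    by (simp add: algebra_simps)
  then show ?thesis using rel1 rel3 by simp
qed

lemma relation_length:
  "(a * c1 - b * r31) + (- a * r12 - b * r32) + (b * c3 - a * r13) = a * \<delta>1 - b * \<delta>3"
  by (simp add: \<delta>1_def \<delta>3_def algebra_simps)

text \<open>\<open>n1\<close> is smaller than both generators on the right of \<open>rel1\<close>,
  so more copies of it are needed; \<open>n3\<close> is larger than both on the right of
  \<open>rel3\<close>, so fewer copies suffice.\<close>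

lemma delta_pos: "0 < \<delta>1" "0 < \<delta>3"
proof -
  have "(r12 + r13) * n1 < c1 * n1"
  proof -
    have "r12 * n1 < r12 * n2" "r13 * n1 < r13 * n3"
      using n_order r_pos by (auto intro!: mult_strict_left_mono)
    then show ?thesis unfolding rel1 by (simp add: algebra_simps)
  qed
  then show "0 < \<delta>1" using n_order by (simp add: \<delta>1_def)
  have "c3 * n3 < (r31 + r32) * n3"
  proof -
    have "r31 * n1 < r31 * n3" "r32 * n2 < r32 * n3"
      using n_order r_pos by (auto intro!: mult_strict_left_mono)
    then show ?thesis unfolding rel3 by (simp add: algebra_simps)
  qed
  then show "0 < \<delta>3" using n_order by (simp add: \<delta>3_def)
qed

text \<open>The relation \<delta>3 v1 + \<delta>1 v3 has length 0, hence is proportional to (n3 - n2, n1 - n3, n2 - n1).\<close>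
lemma slope1: "\<delta>1 * r31 < \<delta>3 * c1"
  and slope3: "\<delta>3 * r13 < \<delta>1 * c3"
proof -
  \<comment> \<open>The coordinates of the relation of length 0 are \<open>u1\<close>,
    \<open>- (u1 + u3)\<close>, \<open>u3\<close>. The equation \<open>eq\<close> below gives
    \<open>u1\<close> and \<open>u3\<close> the same sign, and their sum is positive.\<close>
  define u1 where "u1 = \<delta>3 * c1 - \<delta>1 * r31"
  define u3 where "u3 = \<delta>1 * c3 - \<delta>3 * r13"
  have "u1 + u3 = \<delta>3 * r12 + \<delta>1 * r32"
    by (simp add: u1_def u3_def \<delta>1_def \<delta>3_def algebra_simps)
  also have "\<dots> > 0" using delta_pos r_pos by (simp add: add_pos_pos)
  finally have pos: "0 < u1 + u3" .
  have "u1 * n1 - (u1 + u3) * n2 + u3 * n3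
      = \<delta>3 * (c1 * n1 - r12 * n2 - r13 * n3) + \<delta>1 * (c3 * n3 - r31 * n1 - r32 * n2)"
    unfolding \<open>u1 + u3 = _\<close> by (simp add: u1_def u3_def algebra_simps)
  also have "\<dots> = 0" using rel1 rel3 by simp
  finally have eq: "u1 * (n2 - n1) = u3 * (n3 - n2)" by (simp add: algebra_simps)
  have "0 < n2 - n1" "0 < n3 - n2" using n_order by auto
  with eq have "0 < u1 \<longleftrightarrow> 0 < u3" by (metis zero_less_mult_pos2 mult_pos_pos)
  with pos have "0 < u1" "0 < u3" by auto
  then show "\<delta>1 * r31 < \<delta>3 * c1" "\<delta>3 * r13 < \<delta>1 * c3" by (auto simp: u1_def u3_def)
qed

text \<open>With z = a v1 + b v3, the lower bounds min 0 z are those imposed by the smallest pair of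
  factorizations with difference z: larger pairs only leave room for more intermediate lengths.\<close>
definition gap :: "int \<Rightarrow> int \<Rightarrow> bool" where
  "gap a b \<longleftrightarrow> 0 < a * \<delta>1 - b * \<delta>3 \<and>
    (\<forall>a' b'. 0 < a' * \<delta>1 - b' * \<delta>3 \<longrightarrow> a' * \<delta>1 - b' * \<delta>3 < a * \<delta>1 - b * \<delta>3 \<longrightarrow>
      \<not> (min 0 (a * c1 - b * r31) \<le> a' * c1 - b' * r31 \<and>
         min 0 (- a * r12 - b * r32) \<le> - a' * r12 - b' * r32 \<and>
         min 0 (b * c3 - a * r13) \<le> b' * c3 - a' * r13))"

lemma gapD:
  assumes "gap a b" "0 < a' * \<delta>1 - b' * \<delta>3" "a' * \<delta>1 - b' * \<delta>3 < a * \<delta>1 - b * \<delta>3"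
    "min 0 (a * c1 - b * r31) \<le> a' * c1 - b' * r31"
    "min 0 (- a * r12 - b * r32) \<le> - a' * r12 - b' * r32"
    "min 0 (b * c3 - a * r13) \<le> b' * c3 - a' * r13"
  shows False
  using assms unfolding gap_def by blast

section \<open>Gaps and indecomposable vectors\<close>

lemma not_gap_opposite:
  assumes "0 < a" "b < 0"
  shows "\<not> gap a b"
proof
  assume g: "gap a b"
  have "0 < a * \<delta>1" using assms delta_pos by simp
  moreover have "\<delta>3 \<le> - b * \<delta>3"
    using assms delta_pos mult_right_mono[of 1 "- b" \<delta>3] by simp
  ultimately have len: "\<delta>3 < a * \<delta>1 - b * \<delta>3" by simp
  have "0 \<le> a * r13" using assms r_pos by simp
  moreover have "c3 \<le> - b * c3"
    using assms r_pos r_less mult_right_mono[of 1 "- b" c3] by simp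
  ultimately have "b * c3 - a * r13 \<le> - c3" by simp
  \<comment> \<open>The witness - v3 = \<open>(r31, r32, - c3)\<close> has length
    \<open>\<delta>3\<close>. Its only negative coordinate is not below that of z, since
    \<open>b \<le> - 1\<close>.\<close>
  then show False
    using len delta_pos r_pos
    by (intro gapD[OF g, of 0 "-1"]) (simp_all add: min.coboundedI1 min.coboundedI2)
qed

text \<open>By \<open>slope3\<close>, a positive length forces
  \<open>x / y < \<delta>3 / \<delta>1 < c3 / r13\<close>. Hence - (x v1 + y v3) has a negative
  third coordinate.\<close>

lemma lambda_third_pos:
  assumes "0 \<le> x" "0 < y * \<delta>3 - x * \<delta>1"
  shows "0 < y * c3 - x * r13"
proof -
  have c3: "0 < c3" using r_less r_pos by simp
  have "x * (\<delta>3 * r13) \<le> x * (\<delta>1 * c3)" using assms slope3 by (intro mult_left_mono) auto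
  moreover have "0 < (y * \<delta>3 - x * \<delta>1) * c3" using assms c3 by simp
  ultimately have "0 < \<delta>3 * (y * c3 - x * r13)" by (simp add: algebra_simps)
  then show ?thesis using delta_pos by (simp add: zero_less_mult_iff)
qed

text \<open>By \<open>slope1\<close>, a positive length forces
  \<open>y / x < \<delta>1 / \<delta>3 < c1 / r31\<close>. Hence x v1 + y v3 has a positive first
  coordinate.\<close>

lemma mu_first_pos:
  assumes "0 \<le> y" "0 < x * \<delta>1 - y * \<delta>3"
  shows "0 < x * c1 - y * r31"
proof -
  have c1: "0 < c1" using r_less r_pos by simp
  have "y * (\<delta>1 * r31) \<le> y * (\<delta>3 * c1)" using assms slope1 by (intro mult_left_mono) auto
  moreover have "0 < (x * \<delta>1 - y * \<delta>3) * c1" using assms c1 by simp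
  ultimately have "0 < \<delta>1 * (x * c1 - y * r31)" by (simp add: algebra_simps)
  then show ?thesis using delta_pos by (simp add: zero_less_mult_iff)
qed

text \<open>Both summands of a splitting are shorter than z. Their second coordinates are
  nonnegative, and their third ones are negative, hence not below that of z. Only the first
  coordinate can keep a summand from being admissible, and it cannot do so for both.\<close>

lemma not_splits_if_gap_lambda:
  assumes "gap (- x) (- y)"
  shows "\<not> splits \<delta>1 \<delta>3 x y"
proof
  assume "splits \<delta>1 \<delta>3 x y"
  then obtain x1 x2 y1 y2 where h: "0 \<le> x1" "0 \<le> x2" "0 \<le> y1" "0 \<le> y2"
    "x = x1 + x2" "y = y1 + y2" "0 < y1 * \<delta>3 - x1 * \<delta>1" "0 < y2 * \<delta>3 - x2 * \<delta>1"
    unfolding splits_def by blast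
  have third: "0 < y1 * c3 - x1 * r13" "0 < y2 * c3 - x2 * r13"
    using lambda_third_pos h by auto
  have second: "0 \<le> x1 * r12 + y1 * r32" "0 \<le> x2 * r12 + y2 * r32" using h r_pos by auto
  have len: "y1 * \<delta>3 - x1 * \<delta>1 < y * \<delta>3 - x * \<delta>1" "y2 * \<delta>3 - x2 * \<delta>1 < y * \<delta>3 - x * \<delta>1"
    using h by (simp_all add: algebra_simps)
  \<comment> \<open>Two integers cannot both lie below the minimum of 0 and their sum.\<close>
  have "min 0 (y * r31 - x * c1) \<le> y1 * r31 - x1 * c1 \<or>
        min 0 (y * r31 - x * c1) \<le> y2 * r31 - x2 * c1"
    using h(5,6) by (auto simp: algebra_simps min_def)
  moreover have "x * r13 - y * c3 \<le> x1 * r13 - y1 * c3" "x * r13 - y * c3 \<le> x2 * r13 - y2 * c3"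
    using third h(5,6) by (auto simp: algebra_simps)
  moreover have "\<not> min 0 (y * r31 - x * c1) \<le> y1 * r31 - x1 * c1"
    using h(7) len(1) second(1) \<open>x * r13 - y * c3 \<le> x1 * r13 - y1 * c3\<close>
    by (intro notI gapD[OF assms, of "- x1" "- y1"])
      (simp_all add: min.coboundedI1 min.coboundedI2)
  moreover have "\<not> min 0 (y * r31 - x * c1) \<le> y2 * r31 - x2 * c1"
    using h(8) len(2) second(2) \<open>x * r13 - y * c3 \<le> x2 * r13 - y2 * c3\<close>
    by (intro notI gapD[OF assms, of "- x2" "- y2"])
      (simp_all add: min.coboundedI1 min.coboundedI2)
  ultimately show False by blast
qed

text \<open>Now the summands have positive first coordinates, and their second ones are nonpositive
  but not below that of z. The third coordinate decides, and again it admits at least one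
  summand.\<close>

lemma not_splits_if_gap_mu:
  assumes "gap x y"
  shows "\<not> splits \<delta>3 \<delta>1 y x"
proof
  assume "splits \<delta>3 \<delta>1 y x"
  then obtain y1 y2 x1 x2 where h: "0 \<le> y1" "0 \<le> y2" "0 \<le> x1" "0 \<le> x2"
    "y = y1 + y2" "x = x1 + x2" "0 < x1 * \<delta>1 - y1 * \<delta>3" "0 < x2 * \<delta>1 - y2 * \<delta>3"
    unfolding splits_def by blast
  have first: "0 < x1 * c1 - y1 * r31" "0 < x2 * c1 - y2 * r31"
    using mu_first_pos h by auto
  have len: "x1 * \<delta>1 - y1 * \<delta>3 < x * \<delta>1 - y * \<delta>3" "x2 * \<delta>1 - y2 * \<delta>3 < x * \<delta>1 - y * \<delta>3"
    using h by (simp_all add: algebra_simps)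
  have second: "- x * r12 - y * r32 \<le> - x1 * r12 - y1 * r32"
    "- x * r12 - y * r32 \<le> - x2 * r12 - y2 * r32"
  proof -
    have "0 \<le> x1 * r12 + y1 * r32" "0 \<le> x2 * r12 + y2 * r32" using h r_pos by auto
    then show "- x * r12 - y * r32 \<le> - x1 * r12 - y1 * r32"
      "- x * r12 - y * r32 \<le> - x2 * r12 - y2 * r32"
      using h(5,6) by (auto simp: algebra_simps)
  qed
  have "min 0 (y * c3 - x * r13) \<le> y1 * c3 - x1 * r13 \<or>
        min 0 (y * c3 - x * r13) \<le> y2 * c3 - x2 * r13"
    using h(5,6) by (auto simp: algebra_simps min_def)
  moreover have "\<not> min 0 (y * c3 - x * r13) \<le> y1 * c3 - x1 * r13"
    using h(7) len(1) second(1) first(1)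
    by (intro notI gapD[OF assms, of x1 y1]) (simp_all add: min.coboundedI1 min.coboundedI2)
  moreover have "\<not> min 0 (y * c3 - x * r13) \<le> y2 * c3 - x2 * r13"
    using h(8) len(2) second(2) first(2)
    by (intro notI gapD[OF assms, of x2 y2]) (simp_all add: min.coboundedI1 min.coboundedI2)
  ultimately show False by blast
qed

text \<open>An admissible w turns out to be - (x' v1 + y' v3) with \<open>x' \<ge> 0\<close> and
  \<open>y' > 0\<close>. If \<open>x' \<le> x\<close> and \<open>y' \<le> y\<close>, then w and z -
  w form a splitting. Every other position contradicts the bound \<open>\<delta>3\<close> on the
  length of z combined with the bounds on the first and third coordinates.\<close>

lemma gap_lambda:
  assumes x: "0 \<le> x" and y: "0 < y" and pos: "0 < y * \<delta>3 - x * \<delta>1"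
    and irr: "\<not> splits \<delta>1 \<delta>3 x y"
  shows "gap (- x) (- y)"
proof (rule ccontr)
  assume "\<not> ?thesis"
  then obtain a b where "0 < a * \<delta>1 - b * \<delta>3" "a * \<delta>1 - b * \<delta>3 < y * \<delta>3 - x * \<delta>1"
    "min 0 (y * r31 - x * c1) \<le> a * c1 - b * r31"
    "min 0 (x * r12 + y * r32) \<le> - a * r12 - b * r32"
    "min 0 (x * r13 - y * c3) \<le> b * c3 - a * r13"
    using pos unfolding gap_def by auto
  moreover define x' y' where "x' = - a" and "y' = - b"
  ultimately have w: "0 < y' * \<delta>3 - x' * \<delta>1" "y' * \<delta>3 - x' * \<delta>1 < y * \<delta>3 - x * \<delta>1"
    "min 0 (y * r31 - x * c1) \<le> y' * r31 - x' * c1"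
    "min 0 (x * r12 + y * r32) \<le> x' * r12 + y' * r32"
    "min 0 (x * r13 - y * c3) \<le> x' * r13 - y' * c3"
    by (simp_all add: algebra_simps)
  have c: "0 < c1" "0 < c3" using r_less r_pos by auto
  have le: "y * \<delta>3 - x * \<delta>1 \<le> \<delta>3"
    using length_le_if_not_splits[OF _ x y irr] delta_pos by simp
  have w2: "0 \<le> x' * r12 + y' * r32" using w(4) x y r_pos by simp
  have w3: "x * r13 - y * c3 \<le> x' * r13 - y' * c3"
    using w(5) lambda_third_pos[OF x pos] by simp
  \<comment> \<open>For \<open>x' < 0\<close> the nonnegative second coordinate forces
    \<open>y' > 0\<close>, and w would be longer than \<open>\<delta>3\<close>.\<close>
  have x': "0 \<le> x'"
  proof (rule ccontr)
    assume neg: "\<not> 0 \<le> x'"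
    then have "x' * r12 < 0" using r_pos by (simp add: mult_less_0_iff)
    then have "0 < y' * r32" using w2 by simp
    then have "0 < y'" using r_pos by (simp add: zero_less_mult_iff)
    then have "\<delta>3 \<le> y' * \<delta>3" using delta_pos by simp
    moreover have "x' * \<delta>1 < 0" using neg delta_pos by (simp add: mult_less_0_iff)
    ultimately show False using w(2) le by simp
  qed
  have y': "0 < y'"
  proof -
    have "0 \<le> x' * \<delta>1" using x' delta_pos by simp
    then have "0 < y' * \<delta>3" using w(1) by simp
    then show ?thesis using delta_pos by (simp add: zero_less_mult_iff)
  qed
  \<comment> \<open>From \<open>y \<ge> x + 2\<close> a length of at least
    \<open>2 * \<delta>3\<close> would follow.\<close>
  have near: "y \<le> x + 1" if "\<delta>1 < \<delta>3"
  proof -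
    have "x * \<delta>1 \<le> x * \<delta>3" using x that by (intro mult_left_mono) auto
    then have "(y - x - 1) * \<delta>3 \<le> 0" using le by (simp add: algebra_simps)
    then show ?thesis using delta_pos by (simp add: mult_le_0_iff)
  qed
  have first: "x' < y'" if "0 \<le> y' * r31 - x' * c1"
  proof (rule ccontr)
    assume "\<not> x' < y'"
    then have "y' * r31 \<le> x' * r31" using r_pos by simp
    moreover have "x' * r31 < x' * c1" using \<open>\<not> x' < y'\<close> y' r_less by simp
    ultimately show False using that by simp
  qed
  consider "x' \<le> x" "y' \<le> y" | "y < y'" | "x < x'" "y' \<le> y" by linarith
  then show False
  proof cases
    case 1
    have "0 < (y - y') * \<delta>3 - (x - x') * \<delta>1" using w(2) by (simp add: algebra_simps)
    then have "splits \<delta>1 \<delta>3 x y"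
      unfolding splits_def using 1 x' y' w(1)
      by (intro exI[of _ x'] exI[of _ "x - x'"] exI[of _ y'] exI[of _ "y - y'"]) auto
    with irr show False ..
  next
    case 2
    \<comment> \<open>The third coordinate and \<open>r13 < c3\<close> give \<open>P > Q\<close>. If
      the first coordinate of z is nonpositive, \<open>slope1\<close> is violated. Otherwise
      \<open>x' < y'\<close> pushes \<open>y\<close> up to at least \<open>x + 2\<close>, against
      \<open>near\<close> or against the bound on the length.\<close>
    define P Q where "P = x' - x" and "Q = y' - y"
    have xy': "x' = x + P" "y' = y + Q" by (simp_all add: P_def Q_def)
    have Q: "0 < Q" using 2 by (simp add: Q_def)
    have e3: "Q * c3 \<le> P * r13" using w3 by (simp add: xy' algebra_simps)
    have len: "Q * \<delta>3 < P * \<delta>1" using w(2) by (simp add: xy' algebra_simps)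
    have P: "Q < P"
    proof (rule ccontr)
      assume "\<not> Q < P"
      then have "P * r13 \<le> Q * r13" using r_pos by simp
      moreover have "Q * r13 < Q * c3" using Q r_less by simp
      ultimately show False using e3 by simp
    qed
    show False
    proof (cases "y * r31 - x * c1 \<le> 0")
      case True
      then have "P * c1 \<le> Q * r31" using w(3) by (simp add: xy' algebra_simps)
      then have "\<delta>3 * (P * c1) \<le> \<delta>3 * (Q * r31)" using delta_pos by simp
      moreover have "P * (\<delta>1 * r31) < P * (\<delta>3 * c1)" using slope1 P Q by simp
      moreover have "(Q * \<delta>3) * r31 < (P * \<delta>1) * r31" using len r_pos by simp
      ultimately show False by (simp add: algebra_simps)
    next
      case False
      then have "x' < y'" using w(3) first by simp
      then have far: "x + 2 \<le> y" using P by (simp add: xy')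
      show False
      proof (cases "\<delta>1 < \<delta>3")
        case True
        then show False using near far by simp
      next
        case False
        have "P * \<delta>3 \<le> P * \<delta>1" using False P Q by simp
        moreover have "\<delta>3 \<le> (P - Q) * \<delta>3" using P delta_pos by simp
        moreover have "P * \<delta>1 - Q * \<delta>3 < y * \<delta>3 - x * \<delta>1"
          using w(1) by (simp add: xy' algebra_simps)
        ultimately show False using le by (simp add: algebra_simps)
      qed
    qed
  next
    case 3
    \<comment> \<open>Here z exceeds w in length by at least \<open>\<delta>1\<close>, while z
      itself has length at most \<open>\<delta>3\<close>; so \<open>near\<close> becomes
      available.\<close>
    have "\<delta>1 \<le> (x' - x) * \<delta>1" using 3 delta_pos by simp
    moreover have "0 \<le> (y - y') * \<delta>3" using 3 delta_pos by simp
    moreover have "(x' - x) * \<delta>1 + (y - y') * \<delta>3 < y * \<delta>3 - x * \<delta>1"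
      using w(1) by (simp add: algebra_simps)
    ultimately have "\<delta>1 < \<delta>3" using le by linarith
    show False
    proof (cases "y * r31 - x * c1 \<le> 0")
      case True
      then have "x' * c1 - x * c1 \<le> y' * r31 - y * r31" using w(3) by simp
      moreover have "x * c1 < x' * c1" "y' * r31 \<le> y * r31" using 3 c r_pos by auto
      ultimately show False by simp
    next
      case False
      then have "x' < y'" using w(3) first by simp
      then show False using near[OF \<open>\<delta>1 < \<delta>3\<close>] 3 by simp
    qed
  qed
qed

text \<open>The bound on the length of z is now \<open>\<delta>1\<close>. The second coordinate of z
  is negative, so w may a priori leave the quadrant or even be of the other kind; the sign patterns
  of \<open>(x', y')\<close> are refuted one by one.\<close>

lemma gap_mu:
  assumes y: "0 \<le> y" and x: "0 < x" and pos: "0 < x * \<delta>1 - y * \<delta>3"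
    and irr: "\<not> splits \<delta>3 \<delta>1 y x"
  shows "gap x y"
proof (rule ccontr)
  assume "\<not> ?thesis"
  then obtain x' y' where w: "0 < x' * \<delta>1 - y' * \<delta>3" "x' * \<delta>1 - y' * \<delta>3 < x * \<delta>1 - y * \<delta>3"
    "min 0 (x * c1 - y * r31) \<le> x' * c1 - y' * r31"
    "min 0 (- x * r12 - y * r32) \<le> - x' * r12 - y' * r32"
    "min 0 (y * c3 - x * r13) \<le> y' * c3 - x' * r13"
    using pos unfolding gap_def by auto
  have c: "0 < c1" "0 < c3" using r_less r_pos by auto
  have le: "x * \<delta>1 - y * \<delta>3 \<le> \<delta>1"
    using length_le_if_not_splits[OF _ y x irr] delta_pos by simp
  have w1: "0 \<le> x' * c1 - y' * r31"
    using w(3) mu_first_pos[OF y pos] by simp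
  have w2: "x' * r12 + y' * r32 \<le> x * r12 + y * r32"
  proof -
    have "0 \<le> x * r12" "0 \<le> y * r32" using x y r_pos by simp_all
    then show ?thesis using w(4) by simp
  qed
  consider "0 < x'" "y' < 0" | "x' \<le> 0" "y' < 0" | "0 \<le> y'" by linarith
  then show False
  proof cases
    case 1
    have "\<delta>1 \<le> x' * \<delta>1" "y' * \<delta>3 < 0" using 1 delta_pos by (simp_all add: mult_less_0_iff)
    then show False using w(2) le by simp
  next
    case 2
    \<comment> \<open>This w is of the other kind, and its nonnegative first coordinate gives
      \<open>X < Y\<close>. If \<open>\<delta>1 < \<delta>3\<close>, its length is at least
      \<open>\<delta>3\<close>, which is too long. Otherwise the third coordinate of z is at least
      \<open>- r13\<close>, whereas that of w is at most \<open>- c3\<close>.\<close>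
    define X Y where "X = - x'" and "Y = - y'"
    have XY: "0 \<le> X" "0 < Y" using 2 by (auto simp: X_def Y_def)
    have lw: "0 < Y * \<delta>3 - X * \<delta>1" "Y * \<delta>3 - X * \<delta>1 < x * \<delta>1 - y * \<delta>3"
      using w(1,2) by (simp_all add: X_def Y_def)
    have "X * c1 \<le> Y * r31" using w1 by (simp add: X_def Y_def)
    have less: "X < Y"
    proof (rule ccontr)
      assume "\<not> X < Y"
      then have "Y * r31 \<le> X * r31" using r_pos by simp
      moreover have "X * r31 < X * c1" using \<open>\<not> X < Y\<close> XY r_less by simp
      ultimately show False using \<open>X * c1 \<le> Y * r31\<close> by simp
    qed
    show False
    proof (cases "\<delta>1 < \<delta>3")
      case True
      have "X * \<delta>1 \<le> X * \<delta>3" using True XY by (intro mult_left_mono) auto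
      moreover have "\<delta>3 \<le> (Y - X) * \<delta>3" using less delta_pos by simp
      ultimately show False using lw(2) le True by (simp add: algebra_simps)
    next
      case False
      have "y * \<delta>3 \<le> y * \<delta>1" using False y by (intro mult_left_mono) auto
      then have "(x - y - 1) * \<delta>1 \<le> 0" using le by (simp add: algebra_simps)
      then have "x \<le> y + 1" using delta_pos by (simp add: mult_le_0_iff)
      then have "x * r13 \<le> (y + 1) * r13" using r_pos by simp
      moreover have "y * r13 \<le> y * c3" using y r_less by (intro mult_left_mono) auto
      ultimately have "- r13 \<le> y * c3 - x * r13" by (simp add: algebra_simps)
      moreover have "min 0 (y * c3 - x * r13) \<le> X * r13 - Y * c3"
        using w(5) by (simp add: X_def Y_def)
      ultimately have "Y * c3 \<le> X * r13 + r13" using r_pos by linarith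
      moreover have "(X + 1) * c3 \<le> Y * c3" using less c by simp
      moreover have "X * r13 \<le> X * c3" using XY r_less by (intro mult_left_mono) auto
      ultimately show False using r_less by (simp add: algebra_simps)
    qed
  next
    case 3
    have x': "0 < x'"
    proof -
      have "0 \<le> y' * \<delta>3" using 3 delta_pos by simp
      then have "0 < x' * \<delta>1" using w(1) by simp
      then show ?thesis using delta_pos by (simp add: zero_less_mult_iff)
    qed
    have len: "0 < (x - x') * \<delta>1 - (y - y') * \<delta>3" using w(2) by (simp add: algebra_simps)
    \<comment> \<open>For \<open>x' > x\<close> the lengths would require \<open>y' > y\<close>, the
      second coordinates \<open>y' < y\<close>.\<close>
    have x'x: "x' \<le> x"
    proof (rule ccontr)
      assume "\<not> x' \<le> x"
      then have "(x - x') * \<delta>1 < 0" "x * r12 < x' * r12"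
        using delta_pos r_pos by (simp_all add: mult_less_0_iff)
      then have "(y - y') * \<delta>3 < 0" "y' * r32 < y * r32" using len w2 by simp_all
      then show False using delta_pos r_pos by (simp add: mult_less_0_iff)
    qed
    show False
    proof (cases "y' \<le> y")
      case True
      then have "splits \<delta>3 \<delta>1 y x"
        unfolding splits_def using 3 x' x'x w(1) len
        by (intro exI[of _ y'] exI[of _ "y - y'"] exI[of _ x'] exI[of _ "x - x'"]) auto
      with irr show False ..
    next
      case False
      \<comment> \<open>With \<open>y' > y\<close> the second coordinate forces
        \<open>x' < x\<close>, and z - w would be longer than \<open>\<delta>1\<close>.\<close>
      then have "y * r32 < y' * r32" using r_pos by simp
      then have "x' * r12 < x * r12" using w2 by simp
      then have "x' < x" using r_pos by simp
      then have "\<delta>1 \<le> (x - x') * \<delta>1" using delta_pos by simp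
      moreover have "(y - y') * \<delta>3 < 0" using False delta_pos by (simp add: mult_less_0_iff)
      moreover have "(x - x') * \<delta>1 - (y - y') * \<delta>3 < x * \<delta>1 - y * \<delta>3"
        using w(1) by (simp add: algebra_simps)
      ultimately show False using le by simp
    qed
  qed
qed

text \<open>\<open>not_gap_opposite\<close> and the positivity of the length leave only the two
  quadrants in which \<open>a\<close> and \<open>b\<close> do not have opposite signs; each of them
  yields one disjunct.\<close>

lemma gap_lengths_iff:
  "(\<exists>a b. d = a * \<delta>1 - b * \<delta>3 \<and> gap a b) \<longleftrightarrow> 0 < d \<and>
    ((\<exists>x\<ge>0. \<exists>y\<ge>0. y * \<delta>3 - x * \<delta>1 = d \<and> \<not> splits \<delta>1 \<delta>3 x y) \<or>
     (\<exists>y\<ge>0. \<exists>x\<ge>0. x * \<delta>1 - y * \<delta>3 = d \<and> \<not> splits \<delta>3 \<delta>1 y x))" (is "?L \<longleftrightarrow> ?R")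
proof
  assume ?L
  then obtain a b where ab: "d = a * \<delta>1 - b * \<delta>3" "gap a b" by blast
  then have pos: "0 < d" by (simp add: gap_def)
  have "\<not> (0 < a \<and> b < 0)" using not_gap_opposite ab by blast
  moreover have "\<not> (a < 0 \<and> 0 \<le> b)"
  proof
    assume "a < 0 \<and> 0 \<le> b"
    then have "a * \<delta>1 < 0" "0 \<le> b * \<delta>3" using delta_pos by (simp_all add: mult_less_0_iff)
    then show False using pos ab by simp
  qed
  ultimately consider "a \<le> 0" "b \<le> 0" | "0 \<le> a" "0 \<le> b" by linarith
  then show ?R
  proof cases
    case 1
    have "\<not> splits \<delta>1 \<delta>3 (- a) (- b)" using not_splits_if_gap_lambda[of "- a" "- b"] ab by simp
    then show ?thesis using 1 pos ab by (intro conjI disjI1 exI[of _ "- a"] exI[of _ "- b"]) auto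
  next
    case 2
    then show ?thesis using not_splits_if_gap_mu ab pos by blast
  qed
next
  assume R: ?R
  then have pos: "0 < d" by simp
  from R consider x y where "0 \<le> x" "0 \<le> y" "y * \<delta>3 - x * \<delta>1 = d" "\<not> splits \<delta>1 \<delta>3 x y"
    | x y where "0 \<le> x" "0 \<le> y" "x * \<delta>1 - y * \<delta>3 = d" "\<not> splits \<delta>3 \<delta>1 y x" by blast
  then show ?L
  proof cases
    case 1
    have "0 < y"
    proof (rule ccontr)
      assume "\<not> 0 < y"
      then have "y = 0" using 1 by simp
      moreover have "0 \<le> x * \<delta>1" using 1(1) delta_pos by simp
      ultimately show False using 1(3) pos by simp
    qed
    then have "gap (- x) (- y)" using gap_lambda[OF 1(1) _ _ 1(4)] 1(3) pos by simp
    then show ?thesis using 1(3) by (intro exI[of _ "- x"] exI[of _ "- y"]) simp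
  next
    case 2
    have "0 < x"
    proof (rule ccontr)
      assume "\<not> 0 < x"
      then have "x = 0" using 2 by simp
      moreover have "0 \<le> y * \<delta>3" using 2(2) delta_pos by simp
      ultimately show False using 2(3) pos by simp
    qed
    then have "gap x y" using gap_mu[OF 2(2) _ _ 2(4)] 2(3) pos by simp
    then show ?thesis using 2 by blast
  qed
qed

end

section \<open>Bezout couples\<close>

lemma lambda_bez_unique:
  fixes p q :: int
  assumes "coprime p q" "0 < p" "0 < q"
    and "x * p + y * q = x' * p + y' * q" "0 < y" "y \<le> p" "0 < y'" "y' \<le> p"
  shows "x = x' \<and> y = y'"
proof -
  have "(y - y') * q = (x' - x) * p" using assms(4) by (simp add: algebra_simps)
  then have "p dvd (y - y') * q" by simp
  then have "p dvd y - y'" using assms(1) by (simp add: coprime_dvd_mult_left_iff)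
  moreover have "\<bar>y - y'\<bar> < p" using assms(5-8) by simp
  ultimately have "y = y'" using dvd_imp_le_int[of "y - y'" p] assms(2) by force
  then show ?thesis using assms(2,4) by simp
qed

lemma lambda_bez_eqI:
  assumes "coprime p q" "0 < p" "0 < q" "x * p + y * q = i" "0 < y" "y \<le> p"
  shows "lambda_bez p q i = (x, y)"
  unfolding lambda_bez_def
proof (rule the_equality)
  show "case (x, y) of (x, y) \<Rightarrow> x * p + y * q = i \<and> 0 < y \<and> y \<le> p" using assms by simp
  show "z = (x, y)" if "case z of (x, y) \<Rightarrow> x * p + y * q = i \<and> 0 < y \<and> y \<le> p" for z
  proof (cases z)
    case (Pair u v)
    then show ?thesis using that lambda_bez_unique[OF assms(1-3), of u v x y] assms(4-6) by simp
  qed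
qed

lemma bezout_normal_form:
  fixes a b z :: int
  assumes "coprime a b" "0 < b"
  obtains x y where "z = x * a + y * b" "0 \<le> x" "x < b"
proof -
  obtain u v where "u * a + v * b = 1" using bezout_int[of a b] assms(1) by auto
  then have uv: "(z * u) * a + (z * v) * b = z"
    by (metis (no_types) mult.assoc distrib_left mult.right_neutral)
  define t where "t = (z * u) div b"
  have m: "z * u - t * b = (z * u) mod b" by (simp add: t_def minus_div_mult_eq_mod)
  have "z = (z * u - t * b) * a + (z * v + t * a) * b" using uv by (simp add: algebra_simps)
  moreover have "0 \<le> z * u - t * b" "z * u - t * b < b" using m assms(2) by simp_all
  ultimately show ?thesis using that by blast
qed

lemma lambda_bez_exists:
  fixes p q :: int
  assumes "coprime p q" "0 < p"
  obtains x y where "x * p + y * q = i" "0 < y" "y \<le> p"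
proof -
  have "coprime q p" using assms(1) by (simp add: coprime_commute)
  \<comment> \<open>Reducing \<open>i - q\<close> and adding 1 back turns the residue range from 0
    to \<open>p - 1\<close> into the range from 1 to \<open>p\<close>.\<close>
  then obtain u v where "i - q = u * q + v * p" "0 \<le> u" "u < p"
    using bezout_normal_form[OF _ assms(2), of q "i - q"] by blast
  then show ?thesis using that[of v "u + 1"] by (simp add: algebra_simps)
qed

lemma mu_bez_eq_swap:
  assumes "coprime p q" "0 < p" "0 < q"
  shows "mu_bez p q i = prod.swap (lambda_bez q p i)"
proof -
  have cop: "coprime q p" using assms(1) by (simp add: coprime_commute)
  obtain x y where xy: "x * q + y * p = i" "0 < y" "y \<le> q"
    using lambda_bez_exists[OF cop assms(3)] by metis
  have "mu_bez p q i = (y, x)"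
    unfolding mu_bez_def
  proof (rule the_equality)
    show "case (y, x) of (x, y) \<Rightarrow> x * p + y * q = i \<and> 0 < x \<and> x \<le> q" using xy by (simp add: add.commute)
    show "z = (y, x)" if "case z of (x, y) \<Rightarrow> x * p + y * q = i \<and> 0 < x \<and> x \<le> q" for z
    proof (cases z)
      case (Pair v u)
      then show ?thesis
        using that lambda_bez_unique[OF cop assms(3,2), of u v x y] xy by (simp add: add.commute)
    qed
  qed
  then show ?thesis using lambda_bez_eqI[OF cop assms(3,2) xy] by simp
qed

lemma mu_irred_iff_lambda_irred:
  assumes "coprime p q" "0 < p" "0 < q"
  shows "mu_irred p q i \<longleftrightarrow> lambda_irred q p i"
proof -
  have "padd (prod.swap u) (prod.swap v) = prod.swap (padd u v)" for u v
    by (simp add: padd_def)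
  moreover have "prod.swap u = prod.swap v \<longleftrightarrow> u = v" for u v :: "int \<times> int"
    by (metis swap_swap)
  ultimately show ?thesis
    by (simp add: mu_irred_def lambda_irred_def mu_bez_eq_swap[OF assms] max.commute)
qed

text \<open>Two positive entries would give a value of at least \<open>p + q\<close>, above the
  maximum. A couple \<open>(x, y)\<close> thus corresponds to a pair \<open>(- x, y)\<close> of
  nonnegative coordinates as in \<open>splits\<close>.\<close>

lemma lambda_bez_nonpos:
  fixes p q :: int
  assumes "0 < p" "0 < q" "i \<le> max p q" "x * p + y * q = i" "0 < y"
  shows "x \<le> 0"
proof (rule ccontr)
  assume "\<not> x \<le> 0"
  then have "p \<le> x * p" "q \<le> y * q" using assms by simp_all
  then show False using assms(1-4) by linarith
qed

text \<open>The parts of a splitting of the normalised pair are couples themselves, because their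
  second entries are positive with sum at most \<open>p\<close>. Conversely, a decomposition of the
  couple of \<open>i\<close> can be shifted to a splitting of any pair in the quadrant with the same
  length.\<close>

lemma lambda_irred_iff_not_splits:
  fixes p q :: int
  assumes cop: "coprime p q" and p: "0 < p" and q: "0 < q" and i: "1 \<le> i"
  shows "i \<le> max p q \<and> lambda_irred p q i \<longleftrightarrow>
    (\<exists>x\<ge>0. \<exists>y\<ge>0. y * q - x * p = i \<and> \<not> splits p q x y)" (is "?L \<longleftrightarrow> ?R")
proof
  assume L: ?L
  obtain x y where xy: "x * p + y * q = i" "0 < y" "y \<le> p"
    using lambda_bez_exists[OF cop p] by metis
  have "\<not> splits p q (- x) y"
  proof
    assume "splits p q (- x) y"
    then obtain x1 x2 y1 y2 where h: "0 \<le> x1" "0 \<le> x2" "0 \<le> y1" "0 \<le> y2"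
      "- x = x1 + x2" "y = y1 + y2" "0 < y1 * q - x1 * p" "0 < y2 * q - x2 * p"
      unfolding splits_def by blast
    have "0 < y1" "0 < y2"
    proof -
      have "0 \<le> x1 * p" "0 \<le> x2 * p" using h p by simp_all
      then have "0 < y1 * q" "0 < y2 * q" using h by linarith+
      then show "0 < y1" "0 < y2" using q by (simp_all add: zero_less_mult_iff)
    qed
    define j k where "j = y1 * q - x1 * p" and "k = y2 * q - x2 * p"
    have x: "x = - x1 - x2" using h by simp
    have "i = j + k" using xy(1) h(6) by (simp add: j_def k_def x algebra_simps)
    then have "j \<in> {1..max p q}" "k \<in> {1..max p q}" using L h(7,8) by (auto simp: j_def k_def)
    moreover have "lambda_bez p q j = (- x1, y1)" "lambda_bez p q k = (- x2, y2)"
      using \<open>0 < y1\<close> \<open>0 < y2\<close> xy(3) h(6)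
      by (auto intro!: lambda_bez_eqI[OF cop p q] simp: j_def k_def)
    moreover have "lambda_bez p q i = (x, y)" using lambda_bez_eqI[OF cop p q xy] .
    ultimately have "\<not> lambda_irred p q i"
      unfolding lambda_irred_def not_not using h(6) x
      by (intro bexI[of _ j] bexI[of _ k]) (simp_all add: padd_def)
    then show False using L by simp
  qed
  moreover have "x \<le> 0" using lambda_bez_nonpos[OF p q _ xy(1,2)] L by simp
  ultimately show ?R using xy by (intro exI[of _ "- x"] exI[of _ y] conjI) auto
next
  assume ?R
  then obtain x y where xy: "0 \<le> x" "0 \<le> y" "y * q - x * p = i" "\<not> splits p q x y" by blast
  have y: "0 < y"
  proof -
    have "0 \<le> x * p" using xy p by simp
    then have "0 < y * q" using xy i by linarith
    then show ?thesis using q by (simp add: zero_less_mult_iff)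
  qed
  have le: "i \<le> max p q" using length_le_if_not_splits[OF q xy(1) y xy(4)] xy(3) by simp
  moreover have "lambda_irred p q i"
  proof (rule ccontr)
    assume "\<not> lambda_irred p q i"
    then obtain j k where jk: "j \<in> {1..max p q}" "k \<in> {1..max p q}"
      "lambda_bez p q i = padd (lambda_bez p q j) (lambda_bez p q k)"
      unfolding lambda_irred_def by blast
    obtain x0 y0 where i0: "x0 * p + y0 * q = i" "0 < y0" "y0 \<le> p"
      using lambda_bez_exists[OF cop p] by metis
    obtain x1 y1 where j1: "x1 * p + y1 * q = j" "0 < y1" "y1 \<le> p"
      using lambda_bez_exists[OF cop p] by metis
    obtain x2 y2 where k2: "x2 * p + y2 * q = k" "0 < y2" "y2 \<le> p"
      using lambda_bez_exists[OF cop p] by metis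
    have sum: "x0 = x1 + x2" "y0 = y1 + y2"
      using jk(3) lambda_bez_eqI[OF cop p q] i0 j1 k2 by (auto simp: padd_def)
    have neg: "x1 \<le> 0" "x2 \<le> 0" using lambda_bez_nonpos[OF p q] j1 k2 jk by auto
    \<comment> \<open>(x, y) differs from the normalised couple by a multiple t (q, p) of the zero-length vector.\<close>
    have eq: "(y - y0) * q = (x + x0) * p" using xy(3) i0(1) by (simp add: algebra_simps)
    then have "p dvd (y - y0) * q" by simp
    then have "p dvd y - y0" using cop by (simp add: coprime_dvd_mult_left_iff)
    then obtain t where t: "y - y0 = p * t" by blast
    then have "(x + x0) * p = (q * t) * p" using eq by (simp add: algebra_simps)
    then have "x + x0 = q * t" using p by simp
    \<comment> \<open>\<open>t \<le> - 1\<close> would give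
      \<open>y \<le> y0 - p \<le> 0\<close>.\<close>
    have "0 \<le> t"
    proof (rule ccontr)
      assume "\<not> 0 \<le> t"
      then have "p * t \<le> p * (-1)" using p by (intro mult_left_mono) auto
      then show False using t y i0 by simp
    qed
    then have "0 \<le> q * t" "0 \<le> p * t" using p q by simp_all
    \<comment> \<open>The first summand absorbs the whole multiple of the zero-length vector, which
      leaves its length unchanged.\<close>
    moreover have "x = (- x1 + q * t) + (- x2)" "y = (y1 + p * t) + y2"
      using t \<open>x + x0 = q * t\<close> sum by simp_all
    moreover have "0 < (y1 + p * t) * q - (- x1 + q * t) * p" "0 < y2 * q - (- x2) * p"
      using j1 k2 jk by (simp_all add: algebra_simps)
    ultimately have "splits p q x y"
      unfolding splits_def using neg j1 k2
      by (intro exI[of _ "- x1 + q * t"] exI[of _ "- x2"] exI[of _ "y1 + p * t"] exI[of _ y2]) auto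
    with xy show False by simp
  qed
  ultimately show ?L by simp
qed

section \<open>Symmetric semigroups and Herzog's relations\<close>

lemma sg2_commute: "sg2 a b = sg2 b a"
proof -
  have "sg2 a b \<subseteq> sg2 b a" for a b
    unfolding sg2_def by clarify (metis add.commute)
  then show ?thesis by blast
qed

lemma sg3_swap12: "sg3 a b c = sg3 b a c"
proof -
  have "sg3 a b c \<subseteq> sg3 b a c" for a b
    unfolding sg3_def by clarify (metis add.commute)
  then show ?thesis by blast
qed

lemma sg3_swap23: "sg3 a b c = sg3 a c b"
proof -
  have "sg3 a b c \<subseteq> sg3 a c b" for b c
    unfolding sg3_def by clarify (metis add.commute add.assoc)
  then show ?thesis by blast
qed

lemma cmin_commute: "cmin a b c = cmin a c b"
  unfolding cmin_def sg2_commute[of b c] ..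

lemma int_sg2_iff:
  "z \<in> int ` sg2 a b \<longleftrightarrow> (\<exists>x\<ge>0. \<exists>y\<ge>0. z = x * int a + y * int b)"
proof
  assume "z \<in> int ` sg2 a b"
  then obtain x y where "z = int (x * a + y * b)" unfolding sg2_def by blast
  then show "\<exists>x\<ge>0. \<exists>y\<ge>0. z = x * int a + y * int b"
    by (intro exI[of _ "int x"] conjI exI[of _ "int y"]) auto
next
  assume "\<exists>x\<ge>0. \<exists>y\<ge>0. z = x * int a + y * int b"
  then obtain x y where xy: "0 \<le> x" "0 \<le> y" "z = x * int a + y * int b" by blast
  then have "z = int (nat x * a + nat y * b)" by simp
  then show "z \<in> int ` sg2 a b" unfolding sg2_def by blast
qed

lemma int_sg3_iff:
  "z \<in> int ` sg3 a b c \<longleftrightarrow>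
    (\<exists>x1\<ge>0. \<exists>x2\<ge>0. \<exists>x3\<ge>0. z = x1 * int a + x2 * int b + x3 * int c)"
proof
  assume "z \<in> int ` sg3 a b c"
  then obtain x y u where "z = int (x * a + y * b + u * c)" unfolding sg3_def by blast
  then show "\<exists>x1\<ge>0. \<exists>x2\<ge>0. \<exists>x3\<ge>0. z = x1 * int a + x2 * int b + x3 * int c"
    by (intro exI[of _ "int x"] conjI exI[of _ "int y"] exI[of _ "int u"]) auto
next
  assume "\<exists>x1\<ge>0. \<exists>x2\<ge>0. \<exists>x3\<ge>0. z = x1 * int a + x2 * int b + x3 * int c"
  then obtain x y u where xy: "0 \<le> x" "0 \<le> y" "0 \<le> u" "z = x * int a + y * int b + u * int c"
    by blast
  then have "z = int (nat x * a + nat y * b + nat u * c)" by simp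
  then show "z \<in> int ` sg3 a b c" unfolding sg3_def by blast
qed

text \<open>Since 0 is in \<open>S\<close>, \<open>F\<close> is a gap. Every gap z has
  \<open>F - z\<close> in \<open>S\<close>, hence \<open>z \<le> F\<close>; so \<open>F\<close> is
  the Frobenius number.\<close>

lemma symmetric_sg_if_reflection:
  assumes "0 \<in> S" and refl: "\<And>z. z \<in> int ` S \<longleftrightarrow> F - z \<notin> int ` S"
  shows "symmetric_sg S"
proof -
  have "frobenius S = F"
    unfolding frobenius_def
  proof (rule Greatest_equality)
    show "F \<notin> int ` S" using refl[of 0] assms(1) by force
    show "z \<le> F" if "z \<notin> int ` S" for z
    proof -
      have "F - z \<in> int ` S" using refl[of z] that by simp
      then show ?thesis by auto
    qed
  qed
  then show ?thesis unfolding symmetric_sg_def by (metis refl)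
qed

text \<open>Every integer has the form \<open>w * N + D * (x * A + y * B)\<close> with
  \<open>0 \<le> w < D\<close> and \<open>0 \<le> x < B\<close>, and it lies in the semigroup iff
  \<open>y \<ge> 0\<close>. Reflection at \<open>F\<close> replaces \<open>w\<close>,
  \<open>x\<close>, \<open>y\<close> by \<open>D - 1 - w\<close>, \<open>B - 1 - x\<close>,
  \<open>- 1 - y\<close> and so exchanges members and gaps.\<close>

lemma symmetric_sg_gluing:
  fixes a b d m :: nat
  assumes cop: "coprime a b" "coprime d m" and pos: "0 < a" "0 < b" "0 < d"
    and m: "m \<in> sg2 a b"
  shows "symmetric_sg (sg3 (d * a) (d * b) m)"
proof -
  let ?S = "sg3 (d * a) (d * b) m"
  define A B D N where "A = int a" and "B = int b" and "D = int d" and "N = int m"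
  have ABD: "0 < A" "0 < B" "0 < D" "coprime A B" "coprime N D"
    using pos cop by (simp_all add: A_def B_def D_def N_def coprime_commute)
  obtain m1 m2 where m12: "0 \<le> m1" "0 \<le> m2" "N = m1 * A + m2 * B"
    using m int_sg2_iff[of N a b] by (auto simp: N_def A_def B_def)
  have mem: "w * N + D * (x * A + y * B) \<in> int ` ?S \<longleftrightarrow> 0 \<le> y"
    if w: "0 \<le> w" "w < D" and x: "0 \<le> x" "x < B" for w x y
  proof
    assume "0 \<le> y"
    then show "w * N + D * (x * A + y * B) \<in> int ` ?S"
      unfolding int_sg3_iff using w x
      by (intro exI[of _ x] conjI exI[of _ y] exI[of _ w])
        (auto simp: A_def B_def D_def N_def algebra_simps)
  next
    assume "w * N + D * (x * A + y * B) \<in> int ` ?S"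
    then obtain x1 x2 x3 where s: "0 \<le> x1" "0 \<le> x2" "0 \<le> x3"
      "w * N + D * (x * A + y * B) = x1 * (D * A) + x2 * (D * B) + x3 * N"
      unfolding int_sg3_iff by (auto simp: A_def B_def D_def N_def)
    \<comment> \<open>Modulo \<open>D\<close> the coefficient \<open>x3\<close> agrees with
      \<open>w\<close>, so \<open>x3 = w + D * e\<close> with \<open>e \<ge> 0\<close>. The surplus
      \<open>e * N\<close> is rewritten in terms of \<open>A\<close> and \<open>B\<close>;
      comparison modulo \<open>B\<close> then settles the sign of \<open>y\<close>.\<close>
    have "(x3 - w) * N = D * (x * A + y * B - x1 * A - x2 * B)"
      using s(4) by (simp add: algebra_simps)
    then have "D dvd (x3 - w) * N" by simp
    then have "D dvd x3 - w" using ABD(5) by (simp add: coprime_dvd_mult_left_iff coprime_commute)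
    then obtain e where e: "x3 - w = D * e" by blast
    have "0 \<le> e"
    proof (rule ccontr)
      assume "\<not> 0 \<le> e"
      then have "D * e \<le> D * (-1)" using ABD by (intro mult_left_mono) auto
      then show False using e w s by simp
    qed
    have "D * (x * A + y * B) = D * ((x1 + e * m1) * A + (x2 + e * m2) * B)"
    proof -
      have "x3 = w + D * e" using e by simp
      with s(4) have "D * (x * A + y * B) = D * (x1 * A + x2 * B + e * N)"
        by (simp add: algebra_simps)
      then show ?thesis unfolding m12(3) by (simp add: algebra_simps)
    qed
    then have eq: "x * A + y * B = (x1 + e * m1) * A + (x2 + e * m2) * B" using ABD by simp
    define u v where "u = x1 + e * m1" and "v = x2 + e * m2"
    have uv: "0 \<le> u" "0 \<le> v" using s m12 \<open>0 \<le> e\<close> by (simp_all add: u_def v_def)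
    have eq: "(u - x) * A = (y - v) * B" using eq by (simp add: u_def v_def algebra_simps)
    then have "B dvd (u - x) * A" by simp
    then have "B dvd u - x" using ABD(4) by (simp add: coprime_dvd_mult_left_iff coprime_commute)
    then obtain f where f: "u - x = B * f" by blast
    have "0 \<le> f"
    proof (rule ccontr)
      assume "\<not> 0 \<le> f"
      then have "B * f \<le> B * (-1)" using ABD by (intro mult_left_mono) auto
      then show False using f x uv by simp
    qed
    have "0 \<le> (u - x) * A" using \<open>0 \<le> f\<close> f ABD(1,2) by simp
    then have "0 \<le> (y - v) * B" unfolding eq .
    then show "0 \<le> y" using uv ABD by (simp add: zero_le_mult_iff)
  qed
  \<comment> \<open>The value at \<open>w = D - 1\<close>, \<open>x = B - 1\<close>,
    \<open>y = - 1\<close>.\<close>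
  define F where "F = (D - 1) * N + D * ((B - 1) * A - B)"
  show ?thesis
  proof (rule symmetric_sg_if_reflection[where F = F])
    show "0 \<in> ?S" unfolding sg3_def by (auto intro!: exI[of _ 0])
    show "z \<in> int ` ?S \<longleftrightarrow> F - z \<notin> int ` ?S" for z
    proof -
      obtain w t where w: "z = w * N + t * D" "0 \<le> w" "w < D"
        by (rule bezout_normal_form[OF ABD(5,3)])
      obtain x y where x: "t = x * A + y * B" "0 \<le> x" "x < B"
        by (rule bezout_normal_form[OF ABD(4,2)])
      have z: "z = w * N + D * (x * A + y * B)" using w x by (simp add: algebra_simps)
      have "F - z = (D - 1 - w) * N + D * ((B - 1 - x) * A + (- 1 - y) * B)"
        unfolding z F_def by (simp add: algebra_simps)
      then have "F - z \<in> int ` ?S \<longleftrightarrow> 0 \<le> - 1 - y" using mem w x by simp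
      moreover have "z \<in> int ` ?S \<longleftrightarrow> 0 \<le> y" unfolding z using mem w x by simp
      ultimately show ?thesis by auto
    qed
  qed
qed

section \<open>Minimal multiples and Herzog's coefficients\<close>

lemma
  assumes "0 < b"
  shows cmin_pos: "0 < cmin a b c" and cmin_mem: "cmin a b c * a \<in> sg2 b c"
proof -
  have "b * a \<in> sg2 b c" unfolding sg2_def
    by (simp add: mult.commute[of b a]) (metis add.right_neutral mult_zero_left)
  then have "0 < b \<and> b * a \<in> sg2 b c" using assms by simp
  from LeastI[of "\<lambda>m. 0 < m \<and> m * a \<in> sg2 b c", OF this]
  show "0 < cmin a b c" "cmin a b c * a \<in> sg2 b c" by (simp_all add: cmin_def)
qed

lemma cmin_le: "0 < k \<Longrightarrow> k * a \<in> sg2 b c \<Longrightarrow> cmin a b c \<le> k"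
  unfolding cmin_def by (rule Least_le) simp

text \<open>After division by \<open>d = gcd a b\<close>, the hypothesis shows that
  \<open>b'\<close> divides \<open>cmin a b c\<close>. If \<open>c\<close> were outside
  \<open>sg2 a' b'\<close>, its normal form would have a negative coefficient at \<open>b'\<close>
  and give a positive multiple of \<open>a\<close> in \<open>sg2 b c\<close> with factor below
  \<open>b'\<close>. So \<open>c\<close> lies in \<open>sg2 a' b'\<close>, and the semigroup is a
  gluing.\<close>

lemma symmetric_sg_if_cmin_multiple:
  assumes pos: "0 < a" "0 < b" "0 < c" and gcd1: "gcd (gcd a b) c = 1"
    and u: "cmin a b c * a = u * b"
  shows "symmetric_sg (sg3 a b c)"
proof -
  define d where "d = gcd a b"
  obtain a' b' where ab: "a = d * a'" "b = d * b'" "coprime a' b'"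
    using gcd_coprime_exists[of a b] pos unfolding d_def by (metis gcd_eq_0_iff mult.commute not_gr0)
  have d: "0 < d" "0 < a'" "0 < b'" using pos ab by auto
  have "cmin a b c * a' = u * b'" using u d by (simp add: ab)
  then have "b' dvd cmin a b c * a'" by simp
  then have "b' dvd cmin a b c" using ab(3) by (simp add: coprime_dvd_mult_left_iff coprime_commute)
  then have le: "b' \<le> cmin a b c" using cmin_pos[OF pos(2)] by (intro dvd_imp_le)
  have "c \<in> sg2 a' b'"
  proof (rule ccontr)
    assume notin: "c \<notin> sg2 a' b'"
    have "coprime (int a') (int b')" "0 < int b'" using ab d by simp_all
    then obtain x y where xy: "int c = x * int a' + y * int b'" "0 \<le> x" "x < int b'"
      by (rule bezout_normal_form)
    have "y < 0"
    proof (rule ccontr)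
      assume "\<not> y < 0"
      then have "int c \<in> int ` sg2 a' b'" using xy unfolding int_sg2_iff by force
      with notin show False by auto
    qed
    define X Y where "X = nat x" and "Y = nat (- y)"
    have "int (X * a') = int (c + Y * b')" using xy \<open>y < 0\<close> by (simp add: X_def Y_def)
    then have "X * a' = c + Y * b'" by (simp only: of_nat_eq_iff)
    then have "d * (X * a') = d * (c + Y * b')" by simp
    then have "X * a = Y * b + d * c" by (simp add: ab algebra_simps)
    then have "X * a \<in> sg2 b c" unfolding sg2_def by blast
    moreover have "0 < X" using \<open>X * a' = c + Y * b'\<close> pos by (cases X) auto
    ultimately have "cmin a b c \<le> X" by (intro cmin_le)
    then show False using le xy by (simp add: X_def)
  qed
  moreover have "coprime d c" using gcd1 by (simp add: d_def coprime_iff_gcd_eq_1)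
  ultimately have "symmetric_sg (sg3 (d * a') (d * b') c)"
    using symmetric_sg_gluing[OF ab(3) _ d(2,3,1)] by blast
  then show ?thesis using ab(1,2) by simp
qed

text \<open>Invariant under permutations of the generators, so that results about \<open>a\<close>
  carry over to \<open>b\<close> and \<open>c\<close> through the two swaps.\<close>

definition nonsymmetric3 :: "nat \<Rightarrow> nat \<Rightarrow> nat \<Rightarrow> bool" where
  "nonsymmetric3 a b c \<longleftrightarrow> 0 < a \<and> 0 < b \<and> 0 < c \<and> gcd (gcd a b) c = 1 \<and>
     \<not> symmetric_sg (sg3 a b c)"

lemma nonsymmetric3_swap12: "nonsymmetric3 a b c \<Longrightarrow> nonsymmetric3 b a c"
  using gcd.commute[of a b] sg3_swap12[of a b c] by (simp add: nonsymmetric3_def)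

lemma nonsymmetric3_swap23: "nonsymmetric3 a b c \<Longrightarrow> nonsymmetric3 a c b"
  using gcd.assoc[of a b c] gcd.assoc[of a c b] gcd.commute[of b c] sg3_swap23[of a b c]
  by (simp add: nonsymmetric3_def)

text \<open>A zero coefficient would make \<open>cmin a b c * a\<close> a multiple of
  \<open>b\<close> or of \<open>c\<close> alone, which forces symmetry.\<close>

lemma cmin_coeffs_pos:
  assumes "nonsymmetric3 a b c" "cmin a b c * a = u * b + v * c"
  shows "0 < u" "0 < v"
proof -
  have *: "0 < v" if "nonsymmetric3 a b c" "cmin a b c * a = u * b + v * c" for b c u v
    using that symmetric_sg_if_cmin_multiple[of a b c u] by (cases v) (auto simp: nonsymmetric3_def)
  show "0 < v" using *[OF assms] .
  show "0 < u" using *[OF nonsymmetric3_swap23[OF assms(1)], of v u] assms(2)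
    by (simp add: cmin_commute[of a c b] add.commute)
qed

lemma cmin_representation:
  assumes "nonsymmetric3 a b c"
  obtains u v where "0 < u" "0 < v" "cmin a b c * a = u * b + v * c"
proof -
  have "cmin a b c * a \<in> sg2 b c" using cmin_mem assms by (simp add: nonsymmetric3_def)
  then obtain u v where "cmin a b c * a = u * b + v * c" unfolding sg2_def by blast
  then show ?thesis using that cmin_coeffs_pos[OF assms] by blast
qed

text \<open>Otherwise \<open>cmin b a c\<close> copies of \<open>b\<close> can be exchanged for
  \<open>s * a + t * c\<close>. Cancelling \<open>s * a\<close> then leaves a smaller positive
  multiple of \<open>a\<close> in \<open>sg2 b c\<close>.\<close>

lemma cmin_coeff_less:
  assumes ns: "nonsymmetric3 a b c" and u: "cmin a b c * a = u * b + v * c"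
  shows "u < cmin b a c"
proof (rule ccontr)
  assume "\<not> ?thesis"
  then have ge: "cmin b a c \<le> u" by simp
  obtain s t where st: "0 < s" "0 < t" "cmin b a c * b = s * a + t * c"
    using cmin_representation[OF nonsymmetric3_swap12[OF ns]] .
  define k where "k = u - cmin b a c"
  have "u * b = k * b + cmin b a c * b" using ge by (simp add: k_def flip: distrib_right)
  then have eq: "cmin a b c * a = s * a + (k * b + (v + t) * c)"
    using u st(3) by (simp add: algebra_simps)
  have "0 < (v + t) * c" using st ns by (simp add: nonsymmetric3_def)
  then have "s * a < cmin a b c * a" using eq by simp
  then have s: "s < cmin a b c" by simp
  have "(cmin a b c - s) * a = k * b + (v + t) * c" using eq by (simp add: diff_mult_distrib)
  then have "(cmin a b c - s) * a \<in> sg2 b c" unfolding sg2_def by blast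
  then have "cmin a b c \<le> cmin a b c - s" using s by (intro cmin_le) auto
  then show False using s st by simp
qed

text \<open>Two representations with \<open>u' < u\<close> would make \<open>(u - u') * b\<close> a
  multiple of \<open>c\<close>, although \<open>u - u'\<close> is below \<open>cmin b a c\<close> by
  \<open>cmin_coeff_less\<close>.\<close>

lemma cmin_representation_unique:
  assumes ns: "nonsymmetric3 a b c"
    and "cmin a b c * a = u * b + v * c" "cmin a b c * a = u' * b + v' * c"
  shows "u = u' \<and> v = v'"
proof -
  have *: "\<not> u' < u" if e: "cmin a b c * a = u * b + v * c" "cmin a b c * a = u' * b + v' * c"
    for u v u' v'
  proof
    assume less: "u' < u"
    have "u * b = (u - u') * b + u' * b" using less by (simp flip: distrib_right)
    then have "(u - u') * b + v * c = v' * c" using e by simp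
    then have "(u - u') * b = 0 * a + (v' - v) * c" by (simp add: diff_mult_distrib)
    then have "(u - u') * b \<in> sg2 a c" unfolding sg2_def by blast
    then have "cmin b a c \<le> u - u'" using less by (intro cmin_le) auto
    then show False using cmin_coeff_less[OF ns e(1)] by simp
  qed
  have "u = u'" using *[OF assms(2,3)] *[OF assms(3,2)] by simp
  moreover have "0 < c" using ns by (simp add: nonsymmetric3_def)
  ultimately show ?thesis using assms(2,3) by simp
qed

lemma rpair_eq:
  assumes ns: "nonsymmetric3 a b c" and "0 < u" "0 < v" "cmin a b c * a = u * b + v * c"
  shows "rpair a b c = (u, v)"
  unfolding rpair_def
proof (rule the_equality)
  show "case (u, v) of (u, v) \<Rightarrow> 0 < u \<and> 0 < v \<and> cmin a b c * a = u * b + v * c"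
    using assms by simp
  show "z = (u, v)" if "case z of (u, v) \<Rightarrow> 0 < u \<and> 0 < v \<and> cmin a b c * a = u * b + v * c" for z
  proof (cases z)
    case (Pair u' v')
    then have "cmin a b c * a = u' * b + v' * c" using that by simp
    from cmin_representation_unique[OF ns this assms(4)] show ?thesis using Pair by simp
  qed
qed

lemma cmin_le_int:
  fixes x y z :: int
  assumes "0 < x" "y \<le> 0" "z \<le> 0" "x * int a + y * int b + z * int c = 0"
  shows "int (cmin a b c) \<le> x"
proof -
  have "int (nat x * a) = int (nat (- y) * b + nat (- z) * c)" using assms by simp
  then have "nat x * a = nat (- y) * b + nat (- z) * c" by (simp only: of_nat_eq_iff)
  then have "nat x * a \<in> sg2 b c" unfolding sg2_def by blast
  then have "cmin a b c \<le> nat x" using assms by (intro cmin_le) auto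
  then show ?thesis using assms by simp
qed

text \<open>Write v2 for the minimal relation of \<open>n2\<close>. Minimality forces v1 + v2 + v3 =
  0, and a descent that subtracts one of the three vectors, up to sign, takes every relation to
  zero.\<close>

lemma nonsymmetric_relation_lattice:
  assumes ns: "nonsymmetric3 n1 n2 n3" and order: "n1 < n2" "n2 < n3"
  shows "relation_lattice (int n1) (int n2) (int n3) (int (cmin n1 n2 n3)) (int (cmin n3 n1 n2))
    (int (fst (rpair n1 n2 n3))) (int (snd (rpair n1 n2 n3)))
    (int (fst (rpair n3 n1 n2))) (int (snd (rpair n3 n1 n2)))"
proof -
  note ns' = nonsymmetric3_swap12[OF ns]
  note ns'' = nonsymmetric3_swap12[OF nonsymmetric3_swap23[OF ns]]
  have n: "0 < n1" "0 < n2" "0 < n3" using ns by (auto simp: nonsymmetric3_def)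
  obtain s12 s13 where s1: "0 < s12" "0 < s13" "cmin n1 n2 n3 * n1 = s12 * n2 + s13 * n3"
    using cmin_representation[OF ns] .
  obtain s21 s23 where s2: "0 < s21" "0 < s23" "cmin n2 n1 n3 * n2 = s21 * n1 + s23 * n3"
    using cmin_representation[OF ns'] .
  obtain s31 s32 where s3: "0 < s31" "0 < s32" "cmin n3 n1 n2 * n3 = s31 * n1 + s32 * n2"
    using cmin_representation[OF ns''] .
  have less: "s12 < cmin n2 n1 n3" "s13 < cmin n3 n1 n2" "s21 < cmin n1 n2 n3"
    "s23 < cmin n3 n1 n2" "s31 < cmin n1 n2 n3" "s32 < cmin n2 n1 n3"
  proof -
    show "s12 < cmin n2 n1 n3" using cmin_coeff_less[OF ns s1(3)] .
    show "s21 < cmin n1 n2 n3" using cmin_coeff_less[OF ns' s2(3)] .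
    show "s31 < cmin n1 n2 n3"
      using cmin_coeff_less[OF ns'' s3(3)] by (simp add: cmin_commute[of n1 n2 n3])
    have "cmin n1 n3 n2 * n1 = s13 * n3 + s12 * n2"
      using s1(3) by (simp add: cmin_commute[of n1 n2 n3])
    from cmin_coeff_less[OF nonsymmetric3_swap23[OF ns] this] show "s13 < cmin n3 n1 n2" .
    have "cmin n2 n3 n1 * n2 = s23 * n3 + s21 * n1"
      using s2(3) by (simp add: cmin_commute[of n2 n1 n3])
    from cmin_coeff_less[OF nonsymmetric3_swap23[OF ns'] this] show "s23 < cmin n3 n1 n2"
      by (simp add: cmin_commute[of n3 n1 n2])
    have "cmin n3 n2 n1 * n3 = s32 * n2 + s31 * n1"
      using s3(3) by (simp add: cmin_commute[of n3 n1 n2])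
    from cmin_coeff_less[OF nonsymmetric3_swap23[OF ns''] this] show "s32 < cmin n2 n1 n3"
      by (simp add: cmin_commute[of n2 n1 n3])
  qed
  define N1 N2 N3 where N: "N1 = int n1" "N2 = int n2" "N3 = int n3"
  define c1 c2 c3 where c: "c1 = int (cmin n1 n2 n3)" "c2 = int (cmin n2 n1 n3)"
    "c3 = int (cmin n3 n1 n2)"
  define r12 r13 r21 r23 r31 r32 where r: "r12 = int s12" "r13 = int s13" "r21 = int s21"
    "r23 = int s23" "r31 = int s31" "r32 = int s32"
  have Npos: "0 < N1" "0 < N2" "0 < N3" using n by (simp_all add: N)
  have rpos: "0 < r12" "0 < r13" "0 < r21" "0 < r23" "0 < r31" "0 < r32"
    using s1 s2 s3 by (simp_all add: r)
  have rless: "r12 < c2" "r13 < c3" "r21 < c1" "r23 < c3" "r31 < c1" "r32 < c2"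
    using less by (simp_all add: r c)
  have R1: "c1 * N1 = r12 * N2 + r13 * N3"
    using arg_cong[OF s1(3), of int] by (simp add: c r N)
  have R2: "c2 * N2 = r21 * N1 + r23 * N3"
    using arg_cong[OF s2(3), of int] by (simp add: c r N)
  have R3: "c3 * N3 = r31 * N1 + r32 * N2"
    using arg_cong[OF s3(3), of int] by (simp add: c r N)
  have min1: "c1 \<le> x" if "0 < x" "y \<le> 0" "z \<le> 0" "x * N1 + y * N2 + z * N3 = 0" for x y z
    using cmin_le_int[of x y z n1 n2 n3] that by (simp add: c N)
  have min2: "c2 \<le> y" if "0 < y" "x \<le> 0" "z \<le> 0" "x * N1 + y * N2 + z * N3 = 0" for x y z
    using cmin_le_int[of y x z n2 n1 n3] that by (simp add: c N)
  have min3: "c3 \<le> z" if "0 < z" "x \<le> 0" "y \<le> 0" "x * N1 + y * N2 + z * N3 = 0" for x y z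
    using cmin_le_int[of z x y n3 n1 n2] that by (simp add: c N)
  \<comment> \<open>The generators are positive, so a nonzero relation has coordinates of both
    signs; among three coordinates one then stands alone against the other two.\<close>
  have one_sign: "(0 < x \<and> y \<le> 0 \<and> z \<le> 0) \<or> (0 < y \<and> x \<le> 0 \<and> z \<le> 0) \<or> (0 < z \<and> x \<le> 0 \<and> y \<le> 0) \<or>
      (x < 0 \<and> 0 \<le> y \<and> 0 \<le> z) \<or> (y < 0 \<and> 0 \<le> x \<and> 0 \<le> z) \<or> (z < 0 \<and> 0 \<le> x \<and> 0 \<le> y) \<or>
      (x = 0 \<and> y = 0 \<and> z = 0)" if eq: "x * N1 + y * N2 + z * N3 = 0" for x y z
  proof -
    have *: "x = 0 \<and> y = 0 \<and> z = 0"
      if "0 \<le> x" "0 \<le> y" "0 \<le> z" "x * N1 + y * N2 + z * N3 = 0" for x y z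
    proof -
      have "0 \<le> x * N1" "0 \<le> y * N2" "0 \<le> z * N3" using that Npos by simp_all
      then have "x * N1 = 0" "y * N2 = 0" "z * N3 = 0" using that(4) by linarith+
      then show ?thesis using Npos by simp
    qed
    have "0 \<le> x \<and> 0 \<le> y \<and> 0 \<le> z \<longrightarrow> x = 0 \<and> y = 0 \<and> z = 0" using *[OF _ _ _ eq] by blast
    moreover have "x \<le> 0 \<and> y \<le> 0 \<and> z \<le> 0 \<longrightarrow> x = 0 \<and> y = 0 \<and> z = 0"
      using *[of "- x" "- y" "- z"] eq by simp
    ultimately show ?thesis by (smt (verit))
  qed
  have neg: "(- x) * N1 + (- y) * N2 + (- z) * N3 = 0" if "x * N1 + y * N2 + z * N3 = 0" for x y z
    using that by simp
  have sum0: "c1 = r21 + r31 \<and> c2 = r12 + r32 \<and> c3 = r13 + r23"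
  proof -
    \<comment> \<open>The vector v1 + v2 + v3. Each coordinate is smaller in absolute value than the
      corresponding minimal multiple, whereas in a nonzero relation the coordinate standing alone is
      at least that large.\<close>
    define w1 w2 w3 where w: "w1 = c1 - r21 - r31" "w2 = c2 - r12 - r32" "w3 = c3 - r13 - r23"
    have eq: "w1 * N1 + w2 * N2 + w3 * N3 = 0"
      using R1 R2 R3 by (simp add: w algebra_simps)
    have b: "w1 < c1" "w2 < c2" "w3 < c3" "- w1 < c1" "- w2 < c2" "- w3 < c3"
      using rpos rless by (simp_all add: w)
    have "w1 = 0 \<and> w2 = 0 \<and> w3 = 0"
      using one_sign[OF eq] b min1[OF _ _ _ eq] min2[OF _ _ _ eq] min3[OF _ _ _ eq]
        min1[OF _ _ _ neg[OF eq]] min2[OF _ _ _ neg[OF eq]] min3[OF _ _ _ neg[OF eq]]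
      by (smt (verit))
    then show ?thesis by (simp add: w)
  qed
  \<comment> \<open>Subtracting the relation with the same sign pattern decreases the weight
    |x| n1 + |y| n2 + |z| n3, because some negative coordinate is partially cancelled.\<close>
  have gen: "\<exists>a b. x = a * c1 - b * r31 \<and> y = - a * r12 - b * r32 \<and> z = b * c3 - a * r13"
    if "x * N1 + y * N2 + z * N3 = 0" for x y z
    using that
  proof (induction "nat (\<bar>x\<bar> * N1 + \<bar>y\<bar> * N2 + \<bar>z\<bar> * N3)" arbitrary: x y z rule: less_induct)
    case less
    let ?w = "\<lambda>x y z. \<bar>x\<bar> * N1 + \<bar>y\<bar> * N2 + \<bar>z\<bar> * N3"
    let ?P = "\<lambda>x y z. \<exists>a b. x = a * c1 - b * r31 \<and> y = - a * r12 - b * r32 \<and> z = b * c3 - a * r13"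
    have IH: "?P x' y' z'" if "?w x' y' z' < ?w x y z" "x' * N1 + y' * N2 + z' * N3 = 0" for x' y' z'
    proof (rule less.hyps[OF _ that(2)])
      have "0 \<le> ?w x' y' z'" using Npos by simp
      then show "nat (?w x' y' z') < nat (?w x y z)" using that(1) by simp
    qed
    have P_add: "?P x y z"
      if shifted: "?P (x - (e * c1 - f * r31)) (y - (- e * r12 - f * r32)) (z - (f * c3 - e * r13))"
      for e f
    proof -
      obtain a b where "x - (e * c1 - f * r31) = a * c1 - b * r31"
        "y - (- e * r12 - f * r32) = - a * r12 - b * r32" "z - (f * c3 - e * r13) = b * c3 - a * r13"
        using shifted by blast
      then show ?thesis by (intro exI[of _ "a + e"] exI[of _ "b + f"]) (simp add: algebra_simps)
    qed
    have cancel: "\<bar>- t + r\<bar> \<le> t + r \<and> (0 < t \<longrightarrow> \<bar>- t + r\<bar> < t + r)" if "0 \<le> t" "0 < r" for t r :: int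
      using that by auto
    \<comment> \<open>\<open>X\<close> is the absolute value of the coordinate standing alone. Its
      weight drops by \<open>k * A = r * B + s * C\<close>; the other two together grow by less,
      since \<open>Y\<close> and \<open>Z\<close> are not both 0.\<close>
    have step: "k \<le> X \<Longrightarrow> \<bar>X - k\<bar> * A + \<bar>- Y + r\<bar> * B + \<bar>- Z + s\<bar> * C < X * A + Y * B + Z * C"
      if h: "0 < X" "0 \<le> Y" "0 \<le> Z" "0 < A" "0 < B" "0 < C" "0 < r" "0 < s"
        "X * A = Y * B + Z * C" "k * A = r * B + s * C" for X Y Z A B C k r s :: int
    proof -
      assume "k \<le> X"
      have "0 < Y \<or> 0 < Z"
      proof (rule ccontr)
        assume "\<not> ?thesis"
        then have "X * A = 0" using h by simp
        then show False using h by simp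
      qed
      moreover have "\<bar>- Y + r\<bar> * B \<le> (Y + r) * B" "\<bar>- Z + s\<bar> * C \<le> (Z + s) * C"
        using h cancel by (auto intro!: mult_right_mono)
      moreover have "0 < Y \<Longrightarrow> \<bar>- Y + r\<bar> * B < (Y + r) * B" "0 < Z \<Longrightarrow> \<bar>- Z + s\<bar> * C < (Z + s) * C"
        using h cancel by (auto intro!: mult_strict_right_mono)
      ultimately have "\<bar>- Y + r\<bar> * B + \<bar>- Z + s\<bar> * C < (Y + r) * B + (Z + s) * C" by linarith
      then show ?thesis using h(10) \<open>k \<le> X\<close> by (simp add: algebra_simps)
    qed
    note eq = less.prems
    consider (p1) "0 < x" "y \<le> 0" "z \<le> 0" | (p2) "0 < y" "x \<le> 0" "z \<le> 0" | (p3) "0 < z" "x \<le> 0" "y \<le> 0"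
      | (m1) "x < 0" "0 \<le> y" "0 \<le> z" | (m2) "y < 0" "0 \<le> x" "0 \<le> z" | (m3) "z < 0" "0 \<le> x" "0 \<le> y"
      | (zero) "x = 0" "y = 0" "z = 0"
      using one_sign[OF eq] by blast
    then show ?case
    proof cases
      case p1
      have "?P (x - c1) (y + r12) (z + r13)"
        using step[of x "- y" "- z" N1 N2 N3 r12 r13 c1] p1 Npos rpos R1 eq min1[OF p1 eq]
        by (intro IH) (auto simp: algebra_simps)
      then show ?thesis by (intro P_add[of 1 0]) simp
    next
      case m1
      have "?P (x + c1) (y - r12) (z - r13)"
        using step[of "- x" y z N1 N2 N3 r12 r13 c1] m1 Npos rpos R1 eq min1[OF _ _ _ neg[OF eq]]
        by (intro IH) (auto simp: algebra_simps abs_minus_commute)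
      then show ?thesis by (intro P_add[of "-1" 0]) simp
    next
      case p3
      have "?P (x + r31) (y + r32) (z - c3)"
        using step[of z "- x" "- y" N3 N1 N2 r31 r32 c3] p3 Npos rpos R3 eq min3[OF p3 eq]
        by (intro IH) (auto simp: algebra_simps)
      then show ?thesis by (intro P_add[of 0 1]) simp
    next
      case m3
      have "?P (x - r31) (y - r32) (z + c3)"
        using step[of "- z" x y N3 N1 N2 r31 r32 c3] m3 Npos rpos R3 eq min3[OF _ _ _ neg[OF eq]]
        by (intro IH) (auto simp: algebra_simps abs_minus_commute)
      then show ?thesis by (intro P_add[of 0 "-1"]) simp
    next
      case p2
      have "?P (x + r21) (y - c2) (z + r23)"
        using step[of y "- x" "- z" N2 N1 N3 r21 r23 c2] p2 Npos rpos R2 eq min2[OF p2 eq]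
        by (intro IH) (auto simp: algebra_simps)
      \<comment> \<open>By \<open>sum0\<close>, v2 is - v1 - v3, whence the coefficients
        \<open>-1\<close>.\<close>
      then show ?thesis using sum0 by (intro P_add[of "-1" "-1"]) (simp add: algebra_simps)
    next
      case m2
      have "?P (x - r21) (y + c2) (z - r23)"
        using step[of "- y" x z N2 N1 N3 r21 r23 c2] m2 Npos rpos R2 eq min2[OF _ _ _ neg[OF eq]]
        by (intro IH) (auto simp: algebra_simps abs_minus_commute)
      then show ?thesis using sum0 by (intro P_add[of 1 1]) (simp add: algebra_simps)
    next
      case zero
      then show ?thesis by (intro exI[of _ 0]) simp
    qed
  qed
  have "relation_lattice N1 N2 N3 c1 c3 r12 r13 r31 r32"
  proof
    show "0 < N1" "N1 < N2" "N2 < N3" using n order by (simp_all add: N)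
  qed (use rpos rless R1 R3 gen in auto)
  then show ?thesis
    using rpair_eq[OF ns s1] rpair_eq[OF ns'' s3] by (simp add: N c r)
qed

section \<open>The delta set\<close>

text \<open>If \<open>x\<close> and \<open>x + z\<close> are factorizations, then
  \<open>x + w\<close> is nonnegative for every \<open>w \<ge> min 0 z\<close>, so an admissible w
  yields an intermediate length. Conversely, for the smallest pair with difference z, every
  intermediate length comes from such a w.\<close>

lemma delta_set_iff:
  fixes n1 n2 n3 :: nat and d :: int
  shows "d \<in> delta_set n1 n2 n3 \<longleftrightarrow> 0 < d \<and>
    (\<exists>z1 z2 z3. z1 * int n1 + z2 * int n2 + z3 * int n3 = 0 \<and> z1 + z2 + z3 = d \<and>
      (\<forall>w1 w2 w3. w1 * int n1 + w2 * int n2 + w3 * int n3 = 0 \<longrightarrow>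
        0 < w1 + w2 + w3 \<longrightarrow> w1 + w2 + w3 < d \<longrightarrow>
        \<not> (min 0 z1 \<le> w1 \<and> min 0 z2 \<le> w2 \<and> min 0 z3 \<le> w3)))" (is "?L \<longleftrightarrow> ?R")
proof
  assume ?L
  then obtain s a b where ab: "d = int b - int a" "a \<in> lengths n1 n2 n3 s" "b \<in> lengths n1 n2 n3 s"
    "a < b" "\<not> (\<exists>m\<in>lengths n1 n2 n3 s. a < m \<and> m < b)"
    unfolding delta_set_def delta_elem_def by blast
  obtain x1 x2 x3 where x: "a = x1 + x2 + x3" "x1 * n1 + x2 * n2 + x3 * n3 = s"
    using ab(2) unfolding lengths_def by blast
  obtain y1 y2 y3 where y: "b = y1 + y2 + y3" "y1 * n1 + y2 * n2 + y3 * n3 = s"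
    using ab(3) unfolding lengths_def by blast
  define z1 z2 z3 where z: "z1 = int y1 - int x1" "z2 = int y2 - int x2" "z3 = int y3 - int x3"
  have eqx: "int x1 * int n1 + int x2 * int n2 + int x3 * int n3 = int s"
    unfolding x(2)[symmetric] by simp
  have eqy: "int y1 * int n1 + int y2 * int n2 + int y3 * int n3 = int s"
    unfolding y(2)[symmetric] by simp
  have "z1 * int n1 + z2 * int n2 + z3 * int n3 = 0"
    using eqx eqy by (simp add: z algebra_simps)
  moreover have "z1 + z2 + z3 = d" by (simp add: z ab(1) x(1) y(1))
  moreover have "\<not> (min 0 z1 \<le> w1 \<and> min 0 z2 \<le> w2 \<and> min 0 z3 \<le> w3)"
    if w: "w1 * int n1 + w2 * int n2 + w3 * int n3 = 0" "0 < w1 + w2 + w3" "w1 + w2 + w3 < d"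
    for w1 w2 w3
  proof
    assume "min 0 z1 \<le> w1 \<and> min 0 z2 \<le> w2 \<and> min 0 z3 \<le> w3"
    then have nn: "0 \<le> int x1 + w1" "0 \<le> int x2 + w2" "0 \<le> int x3 + w3" by (auto simp: z)
    define u1 u2 u3 where "u1 = nat (int x1 + w1)" "u2 = nat (int x2 + w2)" "u3 = nat (int x3 + w3)"
    then have u: "int u1 = int x1 + w1" "int u2 = int x2 + w2" "int u3 = int x3 + w3"
      using nn by simp_all
    have "int (u1 * n1 + u2 * n2 + u3 * n3) = int s"
      using eqx w(1) by (simp add: u algebra_simps)
    then have "u1 * n1 + u2 * n2 + u3 * n3 = s" by (simp only: of_nat_eq_iff)
    then have "u1 + u2 + u3 \<in> lengths n1 n2 n3 s" unfolding lengths_def by blast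
    moreover have "int a < int (u1 + u2 + u3)" "int (u1 + u2 + u3) < int b"
      using w(2,3) by (simp_all add: u x(1) ab(1))
    ultimately show False using ab(5) by (simp only: of_nat_less_iff) blast
  qed
  moreover have "0 < d" using ab by simp
  ultimately show ?R by blast
next
  assume ?R
  then obtain z1 z2 z3 where d: "0 < d" and z: "z1 * int n1 + z2 * int n2 + z3 * int n3 = 0"
      "z1 + z2 + z3 = d"
    and no: "\<And>w1 w2 w3. w1 * int n1 + w2 * int n2 + w3 * int n3 = 0 \<Longrightarrow>
        0 < w1 + w2 + w3 \<Longrightarrow> w1 + w2 + w3 < d \<Longrightarrow>
        \<not> (min 0 z1 \<le> w1 \<and> min 0 z2 \<le> w2 \<and> min 0 z3 \<le> w3)"
    by blast
  \<comment> \<open>The factorizations \<open>x\<close> and \<open>y\<close> are the negative and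
    the positive part of z.\<close>
  define x1 x2 x3 where "x1 = nat (- min 0 z1)" "x2 = nat (- min 0 z2)" "x3 = nat (- min 0 z3)"
  then have x: "int x1 = - min 0 z1" "int x2 = - min 0 z2" "int x3 = - min 0 z3" by simp_all
  define y1 y2 y3 where "y1 = nat (int x1 + z1)" "y2 = nat (int x2 + z2)" "y3 = nat (int x3 + z3)"
  then have y: "int y1 = int x1 + z1" "int y2 = int x2 + z2" "int y3 = int x3 + z3"
    using x by simp_all
  define s where "s = x1 * n1 + x2 * n2 + x3 * n3"
  have "int (y1 * n1 + y2 * n2 + y3 * n3) = int s"
    using z(1) by (simp add: s_def y algebra_simps)
  then have ys: "y1 * n1 + y2 * n2 + y3 * n3 = s" by (simp only: of_nat_eq_iff)
  define a b where "a = x1 + x2 + x3" "b = y1 + y2 + y3"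
  have "a \<in> lengths n1 n2 n3 s" "b \<in> lengths n1 n2 n3 s"
    unfolding lengths_def a_b_def using ys s_def[symmetric] by blast+
  moreover have db: "d = int b - int a" using z(2) by (simp add: a_b_def y)
  moreover have "a < b" using d db by simp
  moreover have "\<not> (\<exists>m\<in>lengths n1 n2 n3 s. a < m \<and> m < b)"
  proof
    assume "\<exists>m\<in>lengths n1 n2 n3 s. a < m \<and> m < b"
    then obtain u1 u2 u3 where u: "a < u1 + u2 + u3" "u1 + u2 + u3 < b"
      "u1 * n1 + u2 * n2 + u3 * n3 = s"
      unfolding lengths_def by blast
    have eq: "int (u1 * n1 + u2 * n2 + u3 * n3) = int (x1 * n1 + x2 * n2 + x3 * n3)"
      using u(3) by (simp add: s_def)
    have "\<not> (min 0 z1 \<le> int u1 - int x1 \<and> min 0 z2 \<le> int u2 - int x2 \<and> min 0 z3 \<le> int u3 - int x3)"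
    proof (rule no)
      show "(int u1 - int x1) * int n1 + (int u2 - int x2) * int n2 + (int u3 - int x3) * int n3 = 0"
        using eq by (simp add: algebra_simps)
      show "0 < int u1 - int x1 + (int u2 - int x2) + (int u3 - int x3)"
        using u(1) by (simp add: a_b_def)
      show "int u1 - int x1 + (int u2 - int x2) + (int u3 - int x3) < d"
        using u(2) db by (simp add: a_b_def)
    qed
    then show False using x by simp
  qed
  ultimately have "d \<in> delta_elem (lengths n1 n2 n3 s)" unfolding delta_elem_def by blast
  moreover have "s \<in> sg3 n1 n2 n3" unfolding sg3_def s_def by blast
  ultimately show ?L unfolding delta_set_def by blast
qed

lemma delta_set_iff_gap:
  assumes "relation_lattice (int n1) (int n2) (int n3) c1 c3 r12 r13 r31 r32"
  shows "d \<in> delta_set n1 n2 n3 \<longleftrightarrow>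
    (\<exists>a b. d = a * relation_lattice.\<delta>1 c1 r12 r13 - b * relation_lattice.\<delta>3 c3 r31 r32 \<and>
      relation_lattice.gap c1 c3 r12 r13 r31 r32 a b)"
proof -
  interpret relation_lattice "int n1" "int n2" "int n3" c1 c3 r12 r13 r31 r32 by fact
  show ?thesis (is "_ \<longleftrightarrow> ?R")
  proof
    assume "d \<in> delta_set n1 n2 n3"
    then obtain z1 z2 z3 where d: "0 < d" and z: "z1 * int n1 + z2 * int n2 + z3 * int n3 = 0"
        "z1 + z2 + z3 = d"
      and no: "\<And>w1 w2 w3. w1 * int n1 + w2 * int n2 + w3 * int n3 = 0 \<Longrightarrow>
          0 < w1 + w2 + w3 \<Longrightarrow> w1 + w2 + w3 < d \<Longrightarrow>
          \<not> (min 0 z1 \<le> w1 \<and> min 0 z2 \<le> w2 \<and> min 0 z3 \<le> w3)"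
      unfolding delta_set_iff by blast
    obtain a b where ab: "z1 = a * c1 - b * r31" "z2 = - a * r12 - b * r32" "z3 = b * c3 - a * r13"
      using generated[OF z(1)] by blast
    have len: "d = a * \<delta>1 - b * \<delta>3" using z(2) unfolding ab relation_length by simp
    have "gap a b"
      unfolding gap_def len[symmetric]
      using d no[OF relation_eq_zero, unfolded relation_length, unfolded ab] by blast
    with len show ?R by blast
  next
    assume ?R
    then obtain a b where len: "d = a * \<delta>1 - b * \<delta>3" and g: "gap a b" by blast
    have "0 < d" using g len by (simp add: gap_def)
    moreover have "\<not> (min 0 (a * c1 - b * r31) \<le> w1 \<and> min 0 (- a * r12 - b * r32) \<le> w2 \<and>
        min 0 (b * c3 - a * r13) \<le> w3)"
      if w: "w1 * int n1 + w2 * int n2 + w3 * int n3 = 0" "0 < w1 + w2 + w3" "w1 + w2 + w3 < d"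
      for w1 w2 w3
    proof -
      obtain a' b' where ab: "w1 = a' * c1 - b' * r31" "w2 = - a' * r12 - b' * r32"
        "w3 = b' * c3 - a' * r13"
        using generated[OF w(1)] by blast
      have "w1 + w2 + w3 = a' * \<delta>1 - b' * \<delta>3" unfolding ab relation_length ..
      then show ?thesis using gapD[OF g, of a' b'] w(2,3) len ab by metis
    qed
    ultimately show "d \<in> delta_set n1 n2 n3"
      unfolding delta_set_iff using relation_eq_zero[of a b] relation_length[of a b] len by blast
  qed
qed

theorem theorem2p15:
  fixes n1 n2 n3 :: nat
  assumes "0 < n1" and "n1 < n2" and "n2 < n3"
    and "gcd (gcd n1 n2) n3 = 1"
    and "minimally_generated n1 n2 n3"
    and "\<not> symmetric_sg (sg3 n1 n2 n3)"
  shows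
    "let c1 = int (cmin n1 n2 n3); c3 = int (cmin n3 n1 n2);
         r12 = int (fst (rpair n1 n2 n3)); r13 = int (snd (rpair n1 n2 n3));
         r31 = int (fst (rpair n3 n1 n2)); r32 = int (snd (rpair n3 n1 n2));
         d1 = c1 - r12 - r13; d3 = r31 + r32 - c3;
         g = gcd d1 d3; p = d1 div g; q = d3 div g
     in delta_set n1 n2 n3 =
        {g * i | i. i \<in> {1..max p q} \<and> (lambda_irred p q i \<or> mu_irred p q i)}"
proof -
  have "nonsymmetric3 n1 n2 n3" using assms by (simp add: nonsymmetric3_def)
  note lat = nonsymmetric_relation_lattice[OF this assms(2,3)]
  interpret L: relation_lattice "int n1" "int n2" "int n3" "int (cmin n1 n2 n3)" "int (cmin n3 n1 n2)"
    "int (fst (rpair n1 n2 n3))" "int (snd (rpair n1 n2 n3))"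
    "int (fst (rpair n3 n1 n2))" "int (snd (rpair n3 n1 n2))"
    by (fact lat)
  define g p q where gpq: "g = gcd L.\<delta>1 L.\<delta>3" "p = L.\<delta>1 div g" "q = L.\<delta>3 div g"
  have g: "0 < g" using L.delta_pos by (simp add: gpq)
  have d: "L.\<delta>1 = g * p" "L.\<delta>3 = g * q" by (simp_all add: gpq)
  have p: "0 < p" and q: "0 < q" using L.delta_pos g unfolding d by (simp_all add: zero_less_mult_iff)
  have cop: "coprime p q"
    unfolding gpq using L.delta_pos by (intro div_gcd_coprime) auto
  then have cop': "coprime q p" by (simp add: coprime_commute)
  have "k \<in> delta_set n1 n2 n3 \<longleftrightarrow>
      (\<exists>i. k = g * i \<and> i \<in> {1..max p q} \<and> (lambda_irred p q i \<or> mu_irred p q i))" for k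
  proof -
    have factor: "y * (g * q) - x * (g * p) = g * (y * q - x * p)"
      "x * (g * p) - y * (g * q) = g * (x * p - y * q)" for x y
      by (simp_all add: algebra_simps)
    have "k \<in> delta_set n1 n2 n3 \<longleftrightarrow> 0 < k \<and>
        ((\<exists>x\<ge>0. \<exists>y\<ge>0. g * (y * q - x * p) = k \<and> \<not> splits p q x y) \<or>
         (\<exists>y\<ge>0. \<exists>x\<ge>0. g * (x * p - y * q) = k \<and> \<not> splits q p y x))"
      using delta_set_iff_gap[OF lat, of k] L.gap_lengths_iff[of k]
      by (simp only: d splits_scale[OF g] factor)
    \<comment> \<open>All lengths are multiples of \<open>g\<close>, so \<open>k\<close> can be
      replaced by its quotient \<open>i\<close>.\<close>
    also have "\<dots> \<longleftrightarrow> (\<exists>i. k = g * i \<and> 1 \<le> i \<and>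
        ((\<exists>x\<ge>0. \<exists>y\<ge>0. y * q - x * p = i \<and> \<not> splits p q x y) \<or>
         (\<exists>y\<ge>0. \<exists>x\<ge>0. x * p - y * q = i \<and> \<not> splits q p y x)))"
    proof -
      have "0 < g * i \<longleftrightarrow> 1 \<le> i" for i using g by (auto simp: zero_less_mult_iff)
      then show ?thesis by blast
    qed
    also have "\<dots> \<longleftrightarrow> (\<exists>i. k = g * i \<and> i \<in> {1..max p q} \<and> (lambda_irred p q i \<or> mu_irred p q i))"
    proof (rule ex_cong1, rule conj_cong, rule refl)
      \<comment> \<open>The mu-couples are treated as lambda-couples for \<open>(q, p)\<close>, so
        one equivalence handles both disjuncts; it also supplies the bound
        \<open>i \<le> max p q\<close>.\<close>
      fix i
      show "(1 \<le> i \<and>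
          ((\<exists>x\<ge>0. \<exists>y\<ge>0. y * q - x * p = i \<and> \<not> splits p q x y) \<or>
           (\<exists>y\<ge>0. \<exists>x\<ge>0. x * p - y * q = i \<and> \<not> splits q p y x))) \<longleftrightarrow>
        i \<in> {1..max p q} \<and> (lambda_irred p q i \<or> mu_irred p q i)"
        using lambda_irred_iff_not_splits[OF cop p q, of i]
          lambda_irred_iff_not_splits[OF cop' q p, of i]
        unfolding mu_irred_iff_lambda_irred[OF cop p q] max.commute[of q p] atLeastAtMost_iff
        by blast
    qed
    finally show ?thesis .
  qed
  then have "delta_set n1 n2 n3 =
      {g * i | i. i \<in> {1..max p q} \<and> (lambda_irred p q i \<or> mu_irred p q i)}"
    by blast
  then show ?thesis
    unfolding gpq Let_def L.\<delta>1_def L.\<delta>3_def .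
qed

end
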